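(* Let $E=\bigoplus_{k\ge1}\mathbb Q\,e_{2k+1}$, and let $K$ be the kernel of the linear map $$\{\cdot,\cdot\}:\ \Lambda^2E=\bigoplus_{k\geq 1}\mathbb Q\, e_{2k+1}\wedge\bigoplus_{\ell\geq 1}\mathbb Q\, e_{2\ell+1}\longrightarrow \bigoplus_{n\geq 1}P_eV_n$$ induced by the Ihara bracket. Then $K$ is isomorphic to the space of even period polynomials, $$K\cong\bigoplus_{n\ge1}W_{2n}^+ .$$
   Context: $P_e$ denotes projection of a polynomial onto its part even in every variable. $e_{2k+1}\in\mathbb Q[x_1^2,x_2^2]$ is the projection $P_e$ of the image $p_{2k+1}$ of the weight $2k+1$ generator $\sigma_{2k+1}$ of the motivic Lie algebra in $\mathfrak{rbg}_1\subset\mathbb Q[x_1,x_2]$ (the block degree one part of the reduced block graded motivic Lie algebra). Here $\mathfrak{rbg}_1$ is the space of polynomials with $f(0,x)=2f(x,-x)$, $f(-x_1,-x_2)=f(x_1,x_2)=f(x_2,x_1)$ and $\partial^2f/\partial x_1^2=\partial^2 f/\partial x_2^2$; its degree $2k$ part is spanned by $p_{2k+1}=2^{-2k}\big((2^{2k+1}-1)(x_1+x_2)^{2k}+(x_1-x_2)^{2k}\big)$, so that up to a nonzero scalar $e_{2k+1}=P_e\big((x_1-x_2)^{2k}\big)$. The Ihara bracket of $f,g\in\mathbb Q[x_1,x_2]$ of even total degree is $$\{f,g\}(x_1,x_2,x_3)=f(x_1,x_2)\big(g(x_1,x_3)-g(x_2,x_3)\big)+f(x_2,x_3)\big(g(x_1,x_2)-g(x_1,x_3)\big)+f(x_3,x_1)\big(g(x_2,x_3)-g(x_1,x_2)\big).$$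 $V_n\subset\mathbb Q[x_1,x_2,x_3]$ is the space of polynomials $f$ homogeneous of degree $2n$ with: $f(x_1,x_2,x_3)=f(x_2,x_3,x_1)=-f(x_3,x_2,x_1)$; $\frac12\big(f(0,y,z)-f(0,y,-z)\big)=f(-y,y,z)-f(y,-z,z)$; and $\frac{\partial^4f}{\partial x_1^4}+\frac{\partial^4f}{\partial x_2^4}+\frac{\partial^4f}{\partial x_3^4}-2\frac{\partial^4f}{\partial x_1^2\partial x_2^2}-2\frac{\partial^4f}{\partial x_2^2\partial x_3^2}-2\frac{\partial^4f}{\partial x_3^2\partial x_1^2}=0$. One has $P_e(V_n)\subset V_n$. $W_{2n}^+$ is the space of $P\in\mathbb Q[x_1,x_2]$, homogeneous of degree $2n$ and even in each variable, with $P(x_1,0)=P(0,x_2)=0$, $P(x_1,x_2)+P(x_2,x_1)=0$ and $P(x_1,x_2)-P(x_1,x_1+x_2)-P(x_1+x_2,x_2)=0$. *)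

theory Defs
  imports Complex_Main "HOL-Library.Poly_Mapping"
begin

section \<open>Rational vector spaces\<close>

class rat_vector = ab_group_add +
  fixes scaleQ :: "rat \<Rightarrow> 'a \<Rightarrow> 'a"  (infixr \<open>*\<^sub>Q\<close> 75)
  assumes scaleQ_add_right: "c *\<^sub>Q (x + y) = c *\<^sub>Q x + c *\<^sub>Q y"
    and scaleQ_add_left: "(c + d) *\<^sub>Q x = c *\<^sub>Q x + d *\<^sub>Q x"
    and scaleQ_scaleQ: "c *\<^sub>Q d *\<^sub>Q x = (c * d) *\<^sub>Q x"
    and scaleQ_one: "1 *\<^sub>Q x = x"

global_interpretation rat_vector: vector_space "scaleQ :: rat \<Rightarrow> 'a \<Rightarrow> 'a::rat_vector"
  by unfold_locales (simp_all add: scaleQ_add_right scaleQ_add_left scaleQ_scaleQ scaleQ_one)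

instantiation rat :: rat_vector
begin
definition scaleQ_rat :: "rat \<Rightarrow> rat \<Rightarrow> rat" where "scaleQ_rat c x = c * x"
instance by standard (simp_all add: scaleQ_rat_def algebra_simps)
end

instantiation poly_mapping :: (type, rat_vector) rat_vector
begin
lift_definition scaleQ_poly_mapping :: "rat \<Rightarrow> ('a \<Rightarrow>\<^sub>0 'b) \<Rightarrow> ('a \<Rightarrow>\<^sub>0 'b)"
  is "\<lambda>c f k. c *\<^sub>Q f k"
  by (erule rev_finite_subset) auto
instance
  by standard (transfer, simp add: scaleQ_add_right scaleQ_add_left scaleQ_scaleQ scaleQ_one)+
end

lemma lookup_scaleQ [simp]: "Poly_Mapping.lookup (c *\<^sub>Q f) k = c *\<^sub>Q Poly_Mapping.lookup f k"
  by transfer simp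

text \<open>Linear extension of \<open>b\<close> to the free rational vector space on \<open>'k\<close>.\<close>
definition lin_ext :: "('k \<Rightarrow> 'v::rat_vector) \<Rightarrow> ('k \<Rightarrow>\<^sub>0 rat) \<Rightarrow> 'v" where
  "lin_ext b t = (\<Sum>k\<in>Poly_Mapping.keys t. Poly_Mapping.lookup t k *\<^sub>Q b k)"

lemma lin_ext_superset:
  assumes "finite A" "Poly_Mapping.keys t \<subseteq> A"
  shows "lin_ext b t = (\<Sum>k\<in>A. Poly_Mapping.lookup t k *\<^sub>Q b k)"
  unfolding lin_ext_def
  by (rule sum.mono_neutral_left) (use assms in \<open>auto simp: in_keys_iff\<close>)

lemma lin_ext_add: "lin_ext b (s + t) = lin_ext b s + lin_ext b t"
proof -
  let ?A = "Poly_Mapping.keys s \<union> Poly_Mapping.keys t"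
  have "lin_ext b (s + t) = (\<Sum>k\<in>?A. Poly_Mapping.lookup (s + t) k *\<^sub>Q b k)"
    by (rule lin_ext_superset) (simp_all add: Poly_Mapping.keys_add)
  also have "\<dots> = (\<Sum>k\<in>?A. Poly_Mapping.lookup s k *\<^sub>Q b k) + (\<Sum>k\<in>?A. Poly_Mapping.lookup t k *\<^sub>Q b k)"
    by (simp add: lookup_add scaleQ_add_left sum.distrib)
  also have "\<dots> = lin_ext b s + lin_ext b t"
    using lin_ext_superset[of ?A s b] lin_ext_superset[of ?A t b] by simp
  finally show ?thesis .
qed

lemma lin_ext_scale: "lin_ext b (c *\<^sub>Q t) = c *\<^sub>Q lin_ext b t"
proof -
  have "lin_ext b (c *\<^sub>Q t) = (\<Sum>k\<in>Poly_Mapping.keys t. Poly_Mapping.lookup (c *\<^sub>Q t) k *\<^sub>Q b k)"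
    by (rule lin_ext_superset) (auto simp: in_keys_iff scaleQ_rat_def)
  then show ?thesis
    by (simp add: lin_ext_def rat_vector.scale_sum_right scaleQ_rat_def)
qed

lemma linear_lin_ext: "Vector_Spaces.linear scaleQ scaleQ (lin_ext b)"
  by (simp add: Vector_Spaces.linear_iff rat_vector.vector_space_axioms lin_ext_add lin_ext_scale)

lemma lin_ext_0 [simp]: "lin_ext b 0 = 0"
  by (simp add: lin_ext_def)

lemma lin_ext_diff: "lin_ext b (s - t) = lin_ext b s - lin_ext b t"
  using lin_ext_add[of b "s - t" t] by simp

lemma lin_ext_single [simp]: "lin_ext b (Poly_Mapping.single k c) = c *\<^sub>Q b k"
  by (cases "c = 0") (simp_all add: lin_ext_def)

section \<open>The exterior square of a rational vector space\<close>

text \<open>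
  The exterior square is the free vector space on pairs modulo the relations that make
  \<open>(u, v) \<mapsto> u \<and> v\<close> bilinear and alternating.
\<close>

abbreviation free_pair :: "'a \<Rightarrow> 'a \<Rightarrow> ('a \<times> 'a \<Rightarrow>\<^sub>0 rat)" where
  "free_pair u v \<equiv> Poly_Mapping.single (u, v) 1"

definition ext2_relations :: "('a::rat_vector \<times> 'a \<Rightarrow>\<^sub>0 rat) set" where
  "ext2_relations = rat_vector.span
     ({free_pair (u + u') v - free_pair u v - free_pair u' v | u u' v. True}
    \<union> {free_pair u (v + v') - free_pair u v - free_pair u v' | u v v'. True}
    \<union> {free_pair (c *\<^sub>Q u) v - c *\<^sub>Q free_pair u v | c u v. True}
    \<union> {free_pair u (c *\<^sub>Q v) - c *\<^sub>Q free_pair u v | c u v. True}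
    \<union> {free_pair u u | u. True})"

lemma subspace_ext2_relations: "rat_vector.subspace ext2_relations"
  unfolding ext2_relations_def by (rule rat_vector.subspace_span)

lemmas ext2_relations_closed =
  rat_vector.subspace_0[OF subspace_ext2_relations]
  rat_vector.subspace_add[OF subspace_ext2_relations]
  rat_vector.subspace_scale[OF subspace_ext2_relations]
  rat_vector.subspace_neg[OF subspace_ext2_relations]

lemma equivp_ext2_relations:
  "equivp (\<lambda>s t :: 'a::rat_vector \<times> 'a \<Rightarrow>\<^sub>0 rat. s - t \<in> ext2_relations)"
proof (intro equivpI reflpI sympI transpI)
  fix x y z :: "'a \<times> 'a \<Rightarrow>\<^sub>0 rat"
  show "x - x \<in> ext2_relations" by (simp add: ext2_relations_closed)
  show "y - x \<in> ext2_relations" if "x - y \<in> ext2_relations"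
    using ext2_relations_closed(4)[OF that] by simp
  show "x - z \<in> ext2_relations" if "x - y \<in> ext2_relations" "y - z \<in> ext2_relations"
    using ext2_relations_closed(2)[OF that] by simp
qed

quotient_type (overloaded) 'a ext2 =
  "('a::rat_vector \<times> 'a) \<Rightarrow>\<^sub>0 rat" / "\<lambda>s t. s - t \<in> ext2_relations"
  by (rule equivp_ext2_relations)

instantiation ext2 :: (rat_vector) rat_vector
begin

lift_definition zero_ext2 :: "'a ext2" is 0 .

lift_definition plus_ext2 :: "'a ext2 \<Rightarrow> 'a ext2 \<Rightarrow> 'a ext2" is "(+)"
proof -
  fix a b c d :: "'a \<times> 'a \<Rightarrow>\<^sub>0 rat"
  assume "a - b \<in> ext2_relations" "c - d \<in> ext2_relations"
  then have "(a - b) + (c - d) \<in> ext2_relations" by (rule ext2_relations_closed)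
  then show "(a + c) - (b + d) \<in> ext2_relations" by (simp add: algebra_simps)
qed

lift_definition uminus_ext2 :: "'a ext2 \<Rightarrow> 'a ext2" is uminus
proof -
  fix a b :: "'a \<times> 'a \<Rightarrow>\<^sub>0 rat"
  assume "a - b \<in> ext2_relations"
  then have "- (a - b) \<in> ext2_relations" by (rule ext2_relations_closed)
  then show "(- a) - (- b) \<in> ext2_relations" by simp
qed

lift_definition scaleQ_ext2 :: "rat \<Rightarrow> 'a ext2 \<Rightarrow> 'a ext2" is scaleQ
proof -
  fix c and a b :: "'a \<times> 'a \<Rightarrow>\<^sub>0 rat"
  assume "a - b \<in> ext2_relations"
  then have "c *\<^sub>Q (a - b) \<in> ext2_relations" by (rule ext2_relations_closed)
  then show "c *\<^sub>Q a - c *\<^sub>Q b \<in> ext2_relations"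
    by (simp add: rat_vector.scale_right_diff_distrib)
qed

definition minus_ext2 :: "'a ext2 \<Rightarrow> 'a ext2 \<Rightarrow> 'a ext2" where
  "minus_ext2 a b = a + - b"

instance
proof
  fix a b c :: "'a ext2" and r s :: rat
  show "a + b + c = a + (b + c)" by transfer (simp add: algebra_simps ext2_relations_closed)
  show "a + b = b + a" by transfer (simp add: algebra_simps ext2_relations_closed)
  show "0 + a = a" by transfer (simp add: ext2_relations_closed)
  show "- a + a = 0" by transfer (simp add: ext2_relations_closed)
  show "a - b = a + - b" by (fact minus_ext2_def)
  show "r *\<^sub>Q (a + b) = r *\<^sub>Q a + r *\<^sub>Q b"
    by transfer (simp add: scaleQ_add_right ext2_relations_closed)
  show "(r + s) *\<^sub>Q a = r *\<^sub>Q a + s *\<^sub>Q a"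
    by transfer (simp add: scaleQ_add_left ext2_relations_closed)
  show "r *\<^sub>Q s *\<^sub>Q a = (r * s) *\<^sub>Q a"
    by transfer (simp add: scaleQ_scaleQ ext2_relations_closed)
  show "1 *\<^sub>Q a = a" by transfer (simp add: scaleQ_one ext2_relations_closed)
qed

end

lift_definition wedge :: "'a::rat_vector \<Rightarrow> 'a \<Rightarrow> 'a ext2" is free_pair .

lemma lin_ext_relations:
  fixes B :: "'a::rat_vector \<Rightarrow> 'a \<Rightarrow> 'b::rat_vector"
  assumes "\<And>u u' v. B (u + u') v = B u v + B u' v"
    and "\<And>u v v'. B u (v + v') = B u v + B u v'"
    and "\<And>c u v. B (c *\<^sub>Q u) v = c *\<^sub>Q B u v"
    and "\<And>c u v. B u (c *\<^sub>Q v) = c *\<^sub>Q B u v"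
    and "\<And>u. B u u = 0"
    and "t \<in> ext2_relations"
  shows "lin_ext (case_prod B) t = 0"
  using assms(6) unfolding ext2_relations_def
proof (induction rule: rat_vector.span_induct)
  case base
  show ?case
    by (rule rat_vector.subspaceI) (auto simp: lin_ext_add lin_ext_scale)
next
  case (step x)
  then show ?case
    by (auto simp: lin_ext_diff lin_ext_scale assms(1-5) scaleQ_one)
qed

section \<open>Polynomials with rational coefficients\<close>

text \<open>
  Polynomials in variables \<open>x\<^sub>i\<close>, \<open>i\<close> a natural number: finitely supported maps from exponent
  vectors to coefficients, with the convolution product of \<^theory>\<open>HOL-Library.Poly_Mapping\<close>.
\<close>

type_synonym mpoly = "(nat \<Rightarrow>\<^sub>0 nat) \<Rightarrow>\<^sub>0 rat"

definition X :: "nat \<Rightarrow> mpoly" where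
  "X i = Poly_Mapping.single (Poly_Mapping.single i 1) 1"

definition poly_in :: "nat set \<Rightarrow> mpoly set" where
  "poly_in I = {f. \<forall>m\<in>Poly_Mapping.keys f. Poly_Mapping.keys m \<subseteq> I}"

definition homogeneous :: "nat \<Rightarrow> mpoly \<Rightarrow> bool" where
  "homogeneous d f \<longleftrightarrow> (\<forall>m\<in>Poly_Mapping.keys f. (\<Sum>i\<in>Poly_Mapping.keys m. Poly_Mapping.lookup m i) = d)"

text \<open>Simultaneous substitution of \<open>\<sigma> i\<close> for \<open>x\<^sub>i\<close>.\<close>
definition subst :: "(nat \<Rightarrow> mpoly) \<Rightarrow> mpoly \<Rightarrow> mpoly" where
  "subst \<sigma> = lin_ext (\<lambda>m. \<Prod>i\<in>Poly_Mapping.keys m. \<sigma> i ^ Poly_Mapping.lookup m i)"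

definition subst2 :: "mpoly \<Rightarrow> mpoly \<Rightarrow> mpoly \<Rightarrow> mpoly" where
  "subst2 f a b = subst (X(1 := a, 2 := b)) f"

definition subst3 :: "mpoly \<Rightarrow> mpoly \<Rightarrow> mpoly \<Rightarrow> mpoly \<Rightarrow> mpoly" where
  "subst3 f a b c = subst (X(1 := a, 2 := b, 3 := c)) f"

text \<open>
  In a monomial not containing \<open>x\<^sub>i\<close> the truncated subtraction below is harmless: the
  coefficient vanishes.
\<close>
definition pderiv :: "nat \<Rightarrow> mpoly \<Rightarrow> mpoly" where
  "pderiv i = lin_ext (\<lambda>m.
     Poly_Mapping.single (m - Poly_Mapping.single i 1) (of_nat (Poly_Mapping.lookup m i)))"

definition P_e :: "mpoly \<Rightarrow> mpoly" where
  "P_e = lin_ext (\<lambda>m. if \<forall>i. even (Poly_Mapping.lookup m i) then Poly_Mapping.single m 1 else 0)"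

lemma lookup_P_e: "Poly_Mapping.lookup (P_e f) m = (if \<forall>i. even (Poly_Mapping.lookup m i) then Poly_Mapping.lookup f m else 0)"
proof -
  have "Poly_Mapping.lookup (P_e f) m = (\<Sum>k\<in>Poly_Mapping.keys f. if k = m then
      (if \<forall>i. even (Poly_Mapping.lookup m i) then Poly_Mapping.lookup f m else 0) else 0)"
    unfolding P_e_def lin_ext_def lookup_sum
    by (rule sum.cong) (auto simp: lookup_single scaleQ_rat_def)
  then show ?thesis by (auto simp: in_keys_iff)
qed

section \<open>The Ihara bracket and the spaces involved\<close>

definition ihara :: "mpoly \<Rightarrow> mpoly \<Rightarrow> mpoly" where
  "ihara f g =
     subst2 f (X 1) (X 2) * (subst2 g (X 1) (X 3) - subst2 g (X 2) (X 3))
   + subst2 f (X 2) (X 3) * (subst2 g (X 1) (X 2) - subst2 g (X 1) (X 3))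
   + subst2 f (X 3) (X 1) * (subst2 g (X 2) (X 3) - subst2 g (X 1) (X 2))"

text \<open>The polynomials \<open>p k\<close> and \<open>e k\<close> are \<open>p\<^sub>2\<^sub>k\<^sub>+\<^sub>1\<close> and \<open>e\<^sub>2\<^sub>k\<^sub>+\<^sub>1\<close>, of degree \<open>2k\<close>.\<close>

definition p :: "nat \<Rightarrow> mpoly" where
  "p k = (1 / 2 ^ (2 * k)) *\<^sub>Q
     ((2 ^ (2 * k + 1) - 1) *\<^sub>Q (X 1 + X 2) ^ (2 * k) + (X 1 - X 2) ^ (2 * k))"

definition e :: "nat \<Rightarrow> mpoly" where
  "e k = P_e (p k)"

definition E :: "mpoly set" where
  "E = rat_vector.span {e k | k. 1 \<le> k}"

definition V :: "nat \<Rightarrow> mpoly set" where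
  "V n = {f \<in> poly_in {1, 2, 3}. homogeneous (2 * n) f
     \<and> f = subst3 f (X 2) (X 3) (X 1)
     \<and> f = - subst3 f (X 3) (X 2) (X 1)
     \<and> (1 / 2) *\<^sub>Q (subst3 f 0 (X 2) (X 3) - subst3 f 0 (X 2) (- X 3))
         = subst3 f (- X 2) (X 2) (X 3) - subst3 f (X 2) (- X 3) (X 3)
     \<and> (pderiv 1 ^^ 4) f + (pderiv 2 ^^ 4) f + (pderiv 3 ^^ 4) f
         - 2 *\<^sub>Q (pderiv 1 ^^ 2) ((pderiv 2 ^^ 2) f)
         - 2 *\<^sub>Q (pderiv 2 ^^ 2) ((pderiv 3 ^^ 2) f)
         - 2 *\<^sub>Q (pderiv 3 ^^ 2) ((pderiv 1 ^^ 2) f) = 0}"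

definition W_even :: "nat \<Rightarrow> mpoly set" where
  "W_even n = {P \<in> poly_in {1, 2}. homogeneous (2 * n) P
     \<and> P_e P = P
     \<and> subst2 P (X 1) 0 = 0 \<and> subst2 P 0 (X 2) = 0
     \<and> subst2 P (X 1) (X 2) + subst2 P (X 2) (X 1) = 0
     \<and> subst2 P (X 1) (X 2) - subst2 P (X 1) (X 1 + X 2) - subst2 P (X 1 + X 2) (X 2) = 0}"

text \<open>
  Subspaces of \<^typ>\<open>mpoly\<close> that are homogeneous of distinct degrees are independent, so the
  span of their union is their direct sum.
\<close>

definition sum_P_e_V :: "mpoly set" where
  "sum_P_e_V = rat_vector.span (\<Union>n\<in>{1..}. P_e ` V n)"

definition sum_W_even :: "mpoly set" where
  "sum_W_even = rat_vector.span (\<Union>n\<in>{1..}. W_even n)"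

section \<open>The bracket on the exterior square of E\<close>

typedef E_vec = E
  morphisms of_E to_E
  unfolding E_def using rat_vector.span_zero by blast

setup_lifting type_definition_E_vec

instantiation E_vec :: rat_vector
begin
lift_definition zero_E_vec :: E_vec is 0
  unfolding E_def by (rule rat_vector.span_zero)
lift_definition plus_E_vec :: "E_vec \<Rightarrow> E_vec \<Rightarrow> E_vec" is "(+)"
  unfolding E_def by (rule rat_vector.span_add)
lift_definition uminus_E_vec :: "E_vec \<Rightarrow> E_vec" is uminus
  unfolding E_def by (rule rat_vector.span_neg)
lift_definition minus_E_vec :: "E_vec \<Rightarrow> E_vec \<Rightarrow> E_vec" is "(-)"
  unfolding E_def by (rule rat_vector.span_diff)
lift_definition scaleQ_E_vec :: "rat \<Rightarrow> E_vec \<Rightarrow> E_vec" is scaleQ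
  unfolding E_def by (rule rat_vector.span_scale)
instance
  by standard
    (transfer, simp add: scaleQ_add_right scaleQ_add_left scaleQ_scaleQ scaleQ_one algebra_simps)+
end

subsection \<open>Elements of E are symmetric, so the bracket is alternating on E\<close>

lemma scaleQ_eq_mult: "c *\<^sub>Q f = Poly_Mapping.single 0 c * f" for f :: mpoly
proof -
  have "c *\<^sub>Q f = Poly_Mapping.map ((*) c) f"
    by (rule poly_mapping_eqI)
      (auto simp: Poly_Mapping.map.rep_eq scaleQ_rat_def when_def)
  then show ?thesis by (simp add: mult_map_scale_conv_mult)
qed

lemma scaleQ_mult_left: "(c *\<^sub>Q f) * g = c *\<^sub>Q (f * g)"
  and scaleQ_mult_right: "f * (c *\<^sub>Q g) = c *\<^sub>Q (f * g)" for f g :: mpoly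
  by (simp_all add: scaleQ_eq_mult algebra_simps)

lemma subst2_add: "subst2 (f + g) a b = subst2 f a b + subst2 g a b"
  and subst2_scale: "subst2 (c *\<^sub>Q f) a b = c *\<^sub>Q subst2 f a b"
  by (simp_all add: subst2_def subst_def lin_ext_add lin_ext_scale)

lemma ihara_add_left: "ihara (f + f') g = ihara f g + ihara f' g"
  and ihara_add_right: "ihara f (g + g') = ihara f g + ihara f g'"
  by (simp_all add: ihara_def subst2_add algebra_simps)

lemma ihara_scale_left: "ihara (c *\<^sub>Q f) g = c *\<^sub>Q ihara f g"
  and ihara_scale_right: "ihara f (c *\<^sub>Q g) = c *\<^sub>Q ihara f g"
  by (simp_all add: ihara_def subst2_scale scaleQ_mult_left scaleQ_mult_right
      scaleQ_add_right flip: rat_vector.scale_right_diff_distrib)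

definition mono2 :: "nat \<Rightarrow> nat \<Rightarrow> mpoly" where
  "mono2 i j = Poly_Mapping.single (Poly_Mapping.single 1 i + Poly_Mapping.single 2 j) 1"

lemma X_power: "X v ^ i = Poly_Mapping.single (Poly_Mapping.single v i) 1"
  by (induction i) (simp_all add: X_def mult_single flip: single_add)

lemma mono2_eq: "mono2 i j = X 1 ^ i * X 2 ^ j"
  by (simp add: mono2_def X_power mult_single)

lemma P_e_mono2: "P_e (mono2 i j) = (if even i \<and> even j then mono2 i j else 0)"
proof -
  let ?m = "Poly_Mapping.single 1 i + Poly_Mapping.single 2 j :: nat \<Rightarrow>\<^sub>0 nat"
  have lk: "Poly_Mapping.lookup ?m v = (if v = 1 then i else if v = 2 then j else 0)" for v
    by (simp add: lookup_add lookup_single)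
  have "(\<forall>v. even (Poly_Mapping.lookup ?m v)) \<longleftrightarrow> even i \<and> even j"
  proof
    assume *: "\<forall>v. even (Poly_Mapping.lookup ?m v)"
    show "even i \<and> even j" using spec[OF *, of 1] spec[OF *, of 2] unfolding lk by simp
  next
    assume "even i \<and> even j"
    then show "\<forall>v. even (Poly_Mapping.lookup ?m v)" unfolding lk by simp
  qed
  then show ?thesis unfolding P_e_def mono2_def lin_ext_single by simp
qed

lemma subst2_mono2: "subst2 (mono2 i j) a b = a ^ i * b ^ j"
proof -
  let ?m = "Poly_Mapping.single 1 i + Poly_Mapping.single 2 j :: nat \<Rightarrow>\<^sub>0 nat"
  let ?s = "X(1 := a, 2 := b)"
  have "(\<Prod>v\<in>Poly_Mapping.keys ?m. ?s v ^ Poly_Mapping.lookup ?m v) = (\<Prod>v\<in>{1, 2}. ?s v ^ Poly_Mapping.lookup ?m v)"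
    by (rule prod.mono_neutral_left)
      (auto simp: in_keys_iff lookup_add lookup_single when_def split: if_splits)
  then show ?thesis
    by (simp add: subst2_def subst_def mono2_def scaleQ_one lookup_add lookup_single)
qed

lemma P_e_add: "P_e (f + g) = P_e f + P_e g"
  and P_e_scale: "P_e (c *\<^sub>Q f) = c *\<^sub>Q P_e f"
  by (simp_all add: P_e_def lin_ext_add lin_ext_scale)

lemma P_e_sum: "P_e (\<Sum>i\<in>A. f i) = (\<Sum>i\<in>A. P_e (f i))"
  by (induction A rule: infinite_finite_induct) (simp_all add: P_e_add, simp_all add: P_e_def)

lemma subst2_sum: "subst2 (\<Sum>i\<in>A. f i) a b = (\<Sum>i\<in>A. subst2 (f i) a b)"
  by (induction A rule: infinite_finite_induct)
    (simp_all add: subst2_add, simp_all add: subst2_def subst_def)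

lemma of_nat_mult_scaleQ: "of_nat n * f = of_nat n *\<^sub>Q f" for f :: mpoly
  by (simp add: scaleQ_eq_mult)

lemma P_e_binomial:
  assumes "s = 1 \<or> s = (-1::rat)"
  shows "P_e ((X 1 + s *\<^sub>Q X 2) ^ n)
    = (\<Sum>i\<le>n. if even i \<and> even (n - i) then of_nat (n choose i) *\<^sub>Q mono2 i (n - i) else 0)"
proof -
  have pow: "(s *\<^sub>Q X 2) ^ j = s ^ j *\<^sub>Q X 2 ^ j" for j
    by (induction j) (simp_all add: scaleQ_mult_left scaleQ_mult_right scaleQ_scaleQ
        mult.commute)
  have "(X 1 + s *\<^sub>Q X 2) ^ n
      = (\<Sum>i\<le>n. (of_nat (n choose i) * s ^ (n - i)) *\<^sub>Q mono2 i (n - i))"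
    unfolding binomial_ring
    by (rule sum.cong) (simp_all add: pow mono2_eq of_nat_mult_scaleQ scaleQ_mult_left
        scaleQ_mult_right scaleQ_scaleQ mult.commute mult.assoc)
  then have "P_e ((X 1 + s *\<^sub>Q X 2) ^ n)
      = (\<Sum>i\<le>n. (of_nat (n choose i) * s ^ (n - i)) *\<^sub>Q P_e (mono2 i (n - i)))"
    by (simp add: P_e_sum P_e_scale)
  also have "\<dots> = (\<Sum>i\<le>n. if even i \<and> even (n - i)
      then of_nat (n choose i) *\<^sub>Q mono2 i (n - i) else 0)"
    by (rule sum.cong) (use assms in \<open>auto simp: P_e_mono2\<close>)
  finally show ?thesis .
qed

lemma e_eq:
  "e k = 2 *\<^sub>Q (\<Sum>i\<le>2*k. if even i \<and> even (2*k - i)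
     then of_nat (2*k choose i) *\<^sub>Q mono2 i (2*k - i) else 0)"
  (is "_ = 2 *\<^sub>Q ?S")
proof -
  have a: "P_e ((X 1 + X 2) ^ (2*k)) = ?S"
    by (rule P_e_binomial[of 1 "2*k", OF disjI1[OF refl], unfolded scaleQ_one])
  have minus: "X 1 + (-1) *\<^sub>Q X 2 = X 1 - X 2" by simp
  have b: "P_e ((X 1 - X 2) ^ (2*k)) = ?S"
    by (rule P_e_binomial[of "-1" "2*k", OF disjI2[OF refl], unfolded minus])
  have c: "1 / 2 ^ (2*k) * ((2 ^ (2*k + 1) - 1) + 1) = (2::rat)" by simp
  have d: "c *\<^sub>Q (d *\<^sub>Q S + S) = (c * (d + 1)) *\<^sub>Q S" for c d and S :: mpoly
    by (simp add: scaleQ_add_left flip: scaleQ_scaleQ)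
  show ?thesis
    unfolding e_def p_def P_e_add P_e_scale a b d c ..
qed

lemma e_symmetric: "subst2 (e k) a b = subst2 (e k) b a"
proof -
  let ?t = "\<lambda>a b i. if even i \<and> even (2*k - i)
     then of_nat (2*k choose i) *\<^sub>Q (a ^ i * b ^ (2*k - i)) else 0 :: mpoly"
  have 0: "subst2 0 a b = 0" for a b by (simp add: subst2_def subst_def)
  have *: "subst2 (e k) a b = 2 *\<^sub>Q (\<Sum>i\<le>2*k. ?t a b i)" for a b
    unfolding e_eq subst2_scale subst2_sum
    by (intro arg_cong[of _ _ "scaleQ 2"] sum.cong) (auto simp: subst2_scale subst2_mono2 0)
  have "(\<Sum>i\<le>2*k. ?t a b i) = (\<Sum>i\<le>2*k. ?t a b (2*k - i))"
    by (rule sum.reindex_bij_witness[of _ "\<lambda>i. 2*k - i" "\<lambda>i. 2*k - i"]) auto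
  also have "\<dots> = (\<Sum>i\<le>2*k. ?t b a i)"
    by (rule sum.cong) (auto simp: mult.commute simp flip: binomial_symmetric)
  finally show ?thesis by (simp add: *)
qed

lemma E_symmetric:
  assumes "f \<in> E" shows "subst2 f a b = subst2 f b a"
proof -
  have sub: "rat_vector.subspace {f. subst2 f a b = subst2 f b a}"
    by (rule rat_vector.subspaceI)
      (simp add: subst2_def subst_def, simp_all only: mem_Collect_eq subst2_add subst2_scale)
  have "rat_vector.span {e k | k. 1 \<le> k} \<subseteq> {f. subst2 f a b = subst2 f b a}"
    by (rule rat_vector.span_minimal[OF _ sub]) (use e_symmetric in blast)
  with assms show ?thesis unfolding E_def by blast
qed

lemma ihara_self:
  assumes "f \<in> E" shows "ihara f f = 0"
  unfolding ihara_def E_symmetric[OF assms, of "X 3" "X 1"] by (simp add: algebra_simps)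

lift_definition bracket_map :: "E_vec ext2 \<Rightarrow> mpoly"
  is "lin_ext (\<lambda>(u, v). ihara (of_E u) (of_E v))"
proof -
  fix s t :: "E_vec \<times> E_vec \<Rightarrow>\<^sub>0 rat"
  assume "s - t \<in> ext2_relations"
  then have "lin_ext (\<lambda>(u, v). ihara (of_E u) (of_E v)) (s - t) = 0"
    by (rule lin_ext_relations[rotated -1])
      (simp_all add: plus_E_vec.rep_eq scaleQ_E_vec.rep_eq ihara_add_left ihara_add_right
        ihara_scale_left ihara_scale_right ihara_self of_E)
  then show "lin_ext (\<lambda>(u, v). ihara (of_E u) (of_E v)) s
      = lin_ext (\<lambda>(u, v). ihara (of_E u) (of_E v)) t"
    by (simp add: lin_ext_diff)
qed

lemma bracket_map_wedge: "bracket_map (wedge u v) = ihara (of_E u) (of_E v)"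
  by transfer (simp add: scaleQ_one)

lemma linear_bracket_map: "Vector_Spaces.linear scaleQ scaleQ bracket_map"
proof -
  have "bracket_map (s + t) = bracket_map s + bracket_map t" for s t
    by transfer (rule lin_ext_add)
  moreover have "bracket_map (c *\<^sub>Q t) = c *\<^sub>Q bracket_map t" for c t
    by transfer (rule lin_ext_scale)
  ultimately show ?thesis
    by (simp add: Vector_Spaces.linear_iff rat_vector.vector_space_axioms)
qed

definition K :: "E_vec ext2 set" where
  "K = {\<omega>. bracket_map \<omega> = 0}"

text \<open>The part of degree \<open>2n\<close> of the exterior square, \<open>e k\<close> having degree \<open>2k\<close>.\<close>
definition ext2_E_deg :: "nat \<Rightarrow> E_vec ext2 set" where
  "ext2_E_deg n = rat_vector.span
     {wedge u v | u v k l. 1 \<le> k \<and> 1 \<le> l \<and> k + l = n \<and> of_E u = e k \<and> of_E v = e l}"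

end

theory Submission
  imports "HOL-Computational_Algebra.Polynomial" Defs
begin

text \<open>
  Since \<open>e k = (x\<^sub>1 + x\<^sub>2)^(2k) + (x\<^sub>1 - x\<^sub>2)^(2k)\<close>, sending \<open>e k \<and> e l\<close> to the alternating polynomial
  \<open>P = x\<^sub>1^(2k) x\<^sub>2^(2l) - x\<^sub>1^(2l) x\<^sub>2^(2k)\<close> identifies the exterior square with the even alternating
  polynomials that vanish on the axes, and the bracket becomes the sum of
  \<open>R(x\<^sub>1 \<plusminus> x\<^sub>2, - x\<^sub>1 \<plusminus> x\<^sub>3)\<close> over the four choices of signs, where
  \<open>R(a,b) = P(a,b) - P(a,a+b) - P(a+b,b)\<close>. Hence even period polynomials give elements of the kernel.
  Conversely, if the sum vanishes, \<open>x\<^sub>1 = 0\<close> shows that \<open>R\<close> is odd in each variable, and then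
  \<open>x\<^sub>1 = x\<^sub>2\<close> gives \<open>R(u, v) = R(u, v - u)\<close>; so \<open>R(u, m u) = 0\<close> for all \<open>m\<close> and \<open>R = 0\<close>.

  The bracket lands in \<open>V\<close> because the fourth order operator kills every product of a power
  of \<open>x\<^sub>i \<plusminus> x\<^sub>j\<close> and a power of \<open>x\<^sub>i \<plusminus> x\<^sub>k\<close>.
\<close>

section \<open>Expansion in monomials and the induction principle it gives\<close>

lemma poly_mapping_sum_monomials:
  fixes f :: "'k \<Rightarrow>\<^sub>0 rat"
  shows "f = (\<Sum>m\<in>Poly_Mapping.keys f. Poly_Mapping.lookup f m *\<^sub>Q Poly_Mapping.single m 1)"
proof (rule poly_mapping_eqI)
  fix k
  have "Poly_Mapping.lookup (\<Sum>m\<in>Poly_Mapping.keys f. Poly_Mapping.lookup f m *\<^sub>Q Poly_Mapping.single m 1) k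
      = (\<Sum>m\<in>Poly_Mapping.keys f. if m = k then Poly_Mapping.lookup f k else 0)"
    unfolding lookup_sum by (rule sum.cong) (auto simp: lookup_single scaleQ_rat_def)
  then show "Poly_Mapping.lookup f k = Poly_Mapping.lookup (\<Sum>m\<in>Poly_Mapping.keys f.
      Poly_Mapping.lookup f m *\<^sub>Q Poly_Mapping.single m 1) k"
    by (auto simp: in_keys_iff)
qed

text \<open>Identities linear in \<open>f\<close> are reduced to monomials by this rule. A case for
  0 is absent because 0 is a monomial scaled by 0.\<close>

lemma monomial_induct [case_names monom add scale]:
  fixes f :: "'k \<Rightarrow>\<^sub>0 rat"
  assumes monom: "\<And>m. Q (Poly_Mapping.single m 1)"
    and add: "\<And>f g. Q f \<Longrightarrow> Q g \<Longrightarrow> Q (f + g)"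
    and scale: "\<And>c f. Q f \<Longrightarrow> Q (c *\<^sub>Q f)"
  shows "Q f"
proof -
  have zero: "Q 0" using scale[OF monom, of 0] by simp
  have "Q (\<Sum>m\<in>A. Poly_Mapping.lookup f m *\<^sub>Q Poly_Mapping.single m 1)" if "finite A" for A
    using that by induction (simp_all add: zero add scale monom)
  then show ?thesis by (subst poly_mapping_sum_monomials) simp
qed

section \<open>Substitution\<close>

lemma subst_add: "subst \<sigma> (f + g) = subst \<sigma> f + subst \<sigma> g"
  and subst_diff: "subst \<sigma> (f - g) = subst \<sigma> f - subst \<sigma> g"
  and subst_scale: "subst \<sigma> (c *\<^sub>Q f) = c *\<^sub>Q subst \<sigma> f"
  and subst_0 [simp]: "subst \<sigma> 0 = 0"
  by (simp_all add: subst_def lin_ext_add lin_ext_diff lin_ext_scale)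

lemma subst_uminus: "subst \<sigma> (- f) = - subst \<sigma> f"
  using subst_diff[of \<sigma> 0 f] by simp

definition subst_monom :: "(nat \<Rightarrow> mpoly) \<Rightarrow> (nat \<Rightarrow>\<^sub>0 nat) \<Rightarrow> mpoly" where
  "subst_monom \<sigma> m = (\<Prod>i\<in>Poly_Mapping.keys m. \<sigma> i ^ Poly_Mapping.lookup m i)"

lemma subst_single: "subst \<sigma> (Poly_Mapping.single m c) = c *\<^sub>Q subst_monom \<sigma> m"
  by (simp add: subst_def subst_monom_def)

lemma subst_monom_superset:
  assumes "finite A" "Poly_Mapping.keys m \<subseteq> A"
  shows "subst_monom \<sigma> m = (\<Prod>i\<in>A. \<sigma> i ^ Poly_Mapping.lookup m i)"
  unfolding subst_monom_def
  by (rule prod.mono_neutral_left) (use assms in \<open>auto simp: in_keys_iff\<close>)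

lemma subst_monom_add: "subst_monom \<sigma> (m + n) = subst_monom \<sigma> m * subst_monom \<sigma> n"
proof -
  let ?A = "Poly_Mapping.keys m \<union> Poly_Mapping.keys n"
  have "subst_monom \<sigma> (m + n) = (\<Prod>i\<in>?A. \<sigma> i ^ Poly_Mapping.lookup (m + n) i)"
    by (rule subst_monom_superset) (simp_all add: Poly_Mapping.keys_add)
  then show ?thesis
    using subst_monom_superset[of ?A m \<sigma>] subst_monom_superset[of ?A n \<sigma>]
    by (simp add: lookup_add power_add prod.distrib)
qed

text \<open>Both sides are bilinear in \<open>f\<close> and \<open>g\<close>, and on monomials the
  claim is \<open>subst_monom_add\<close>.\<close>

lemma subst_mult: "subst \<sigma> (f * g) = subst \<sigma> f * subst \<sigma> g"
proof (induction f rule: monomial_induct)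
  case (monom m)
  show ?case
    by (induction g rule: monomial_induct)
      (simp_all add: mult_single subst_single subst_monom_add scaleQ_one subst_add subst_scale
        distrib_left scaleQ_mult_right)
qed (simp_all add: distrib_right subst_add subst_scale scaleQ_mult_left)

lemma subst_X [simp]: "subst \<sigma> (X i) = \<sigma> i"
  by (simp add: X_def subst_single subst_monom_def scaleQ_one)

lemma subst_one [simp]: "subst \<sigma> 1 = 1"
  by (simp add: subst_single subst_monom_def scaleQ_one flip: single_one)

lemma subst_power: "subst \<sigma> (f ^ n) = subst \<sigma> f ^ n"
  by (induction n) (simp_all add: subst_mult)

lemma subst_prod: "subst \<sigma> (\<Prod>i\<in>A. f i) = (\<Prod>i\<in>A. subst \<sigma> (f i))"
  by (induction A rule: infinite_finite_induct) (simp_all add: subst_mult)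

lemmas subst_hom = subst_add subst_diff subst_uminus subst_scale subst_mult subst_power

lemma subst_subst: "subst \<tau> (subst \<sigma> f) = subst (\<lambda>i. subst \<tau> (\<sigma> i)) f"
  by (induction f rule: monomial_induct)
    (simp_all add: subst_hom subst_single subst_monom_def subst_prod scaleQ_one)

lemma subst_cong:
  assumes "f \<in> poly_in I" "\<And>i. i \<in> I \<Longrightarrow> \<sigma> i = \<tau> i"
  shows "subst \<sigma> f = subst \<tau> f"
  unfolding subst_def lin_ext_def
proof (rule sum.cong[OF refl], intro arg_cong[of _ _ "scaleQ _"] prod.cong refl)
  fix m i assume "m \<in> Poly_Mapping.keys f" "i \<in> Poly_Mapping.keys m"
  then have "i \<in> I" using assms(1) by (auto simp: poly_in_def)
  then show "\<sigma> i ^ Poly_Mapping.lookup m i = \<tau> i ^ Poly_Mapping.lookup m i"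
    by (simp add: assms(2))
qed

text \<open>\<open>subst2\<close> leaves all variables other than the first two in place, so
  \<open>\<tau>\<close> would still act on them; hence the restriction on \<open>f\<close>.\<close>

lemma subst_subst2:
  assumes "f \<in> poly_in {1, 2}"
  shows "subst \<tau> (subst2 f a b) = subst2 f (subst \<tau> a) (subst \<tau> b)"
  unfolding subst2_def subst_subst by (rule subst_cong[OF assms]) auto

lemma subst2_hom:
  "subst2 (f + g) a b = subst2 f a b + subst2 g a b"
  "subst2 (f - g) a b = subst2 f a b - subst2 g a b"
  "subst2 (- f) a b = - subst2 f a b"
  "subst2 (c *\<^sub>Q f) a b = c *\<^sub>Q subst2 f a b"
  "subst2 (f * g) a b = subst2 f a b * subst2 g a b"
  "subst2 (f ^ n) a b = subst2 f a b ^ n"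
  "subst2 0 a b = 0"
  "subst2 (X (Suc 0)) a b = a"
  "subst2 (X 1) a b = a"
  "subst2 (X 2) a b = b"
  by (simp_all add: subst2_def subst_hom)

section \<open>Support conditions\<close>

definition mdeg :: "(nat \<Rightarrow>\<^sub>0 nat) \<Rightarrow> nat" where
  "mdeg m = (\<Sum>i\<in>Poly_Mapping.keys m. Poly_Mapping.lookup m i)"

lemma mdeg_superset:
  assumes "finite A" "Poly_Mapping.keys m \<subseteq> A"
  shows "mdeg m = (\<Sum>i\<in>A. Poly_Mapping.lookup m i)"
  unfolding mdeg_def
  by (rule sum.mono_neutral_left) (use assms in \<open>auto simp: in_keys_iff\<close>)

lemma mdeg_add: "mdeg (m + n) = mdeg m + mdeg n"
proof -
  let ?A = "Poly_Mapping.keys m \<union> Poly_Mapping.keys n"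
  have "mdeg (m + n) = (\<Sum>i\<in>?A. Poly_Mapping.lookup (m + n) i)"
    by (rule mdeg_superset) (simp_all add: Poly_Mapping.keys_add)
  then show ?thesis
    using mdeg_superset[of ?A m] mdeg_superset[of ?A n] by (simp add: lookup_add sum.distrib)
qed

lemma mdeg_single [simp]: "mdeg (Poly_Mapping.single i n) = n"
  by (simp add: mdeg_def)

lemma homogeneous_iff: "homogeneous d f \<longleftrightarrow> (\<forall>m\<in>Poly_Mapping.keys f. mdeg m = d)"
  by (simp add: homogeneous_def mdeg_def)

lemma keys_scaleQ: "Poly_Mapping.keys (c *\<^sub>Q f) \<subseteq> Poly_Mapping.keys f"
  for f :: "'k \<Rightarrow>\<^sub>0 rat"
  by (auto simp: in_keys_iff scaleQ_rat_def)

lemma keys_uminus_eq: "Poly_Mapping.keys (- f) = Poly_Mapping.keys f" for f :: "'k \<Rightarrow>\<^sub>0 rat"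
  by (auto simp: in_keys_iff)

lemma homogeneous_add: "homogeneous d f \<Longrightarrow> homogeneous d g \<Longrightarrow> homogeneous d (f + g)"
  using Poly_Mapping.keys_add[of f g] by (auto simp: homogeneous_iff)

lemma homogeneous_uminus: "homogeneous d f \<Longrightarrow> homogeneous d (- f)"
  by (simp add: homogeneous_iff keys_uminus_eq)

lemma homogeneous_diff: "homogeneous d f \<Longrightarrow> homogeneous d g \<Longrightarrow> homogeneous d (f - g)"
  using homogeneous_add[of d f "- g"] by (simp add: homogeneous_uminus)

lemma homogeneous_scale: "homogeneous d f \<Longrightarrow> homogeneous d (c *\<^sub>Q f)"
  using keys_scaleQ[of c f] by (auto simp: homogeneous_iff)

lemma homogeneous_0 [simp]: "homogeneous d 0"
  by (simp add: homogeneous_iff)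

lemma homogeneous_mult: "homogeneous c f \<Longrightarrow> homogeneous d g \<Longrightarrow> homogeneous (c + d) (f * g)"
  using Poly_Mapping.keys_mult[of f g] by (fastforce simp: homogeneous_iff mdeg_add)

lemma homogeneous_power: "homogeneous d f \<Longrightarrow> homogeneous (n * d) (f ^ n)"
proof (induction n)
  case 0
  show ?case by (simp add: homogeneous_iff mdeg_def)
next
  case (Suc n)
  then show ?case using homogeneous_mult[of d f "n * d" "f ^ n"] by simp
qed

lemma homogeneous_X [simp]: "homogeneous 1 (X i)" "homogeneous (Suc 0) (X i)"
  by (simp_all add: homogeneous_iff X_def)

lemma poly_in_add: "f \<in> poly_in I \<Longrightarrow> g \<in> poly_in I \<Longrightarrow> f + g \<in> poly_in I"
  using Poly_Mapping.keys_add[of f g] by (auto simp: poly_in_def)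

lemma poly_in_uminus: "f \<in> poly_in I \<Longrightarrow> - f \<in> poly_in I"
  by (simp add: poly_in_def keys_uminus_eq)

lemma poly_in_diff: "f \<in> poly_in I \<Longrightarrow> g \<in> poly_in I \<Longrightarrow> f - g \<in> poly_in I"
  using poly_in_add[of f I "- g"] by (simp add: poly_in_uminus)

lemma poly_in_scale: "f \<in> poly_in I \<Longrightarrow> c *\<^sub>Q f \<in> poly_in I"
  using keys_scaleQ[of c f] by (auto simp: poly_in_def)

lemma poly_in_0 [simp]: "0 \<in> poly_in I"
  by (simp add: poly_in_def)

lemma poly_in_mult:
  assumes "f \<in> poly_in I" "g \<in> poly_in I" shows "f * g \<in> poly_in I"
  unfolding poly_in_def
proof (intro CollectI ballI)
  fix m assume "m \<in> Poly_Mapping.keys (f * g)"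
  then obtain a b where "m = a + b" "a \<in> Poly_Mapping.keys f" "b \<in> Poly_Mapping.keys g"
    using Poly_Mapping.keys_mult[of f g] by blast
  then show "Poly_Mapping.keys m \<subseteq> I"
    using assms Poly_Mapping.keys_add[of a b] unfolding poly_in_def by blast
qed

lemma poly_in_power: "f \<in> poly_in I \<Longrightarrow> f ^ n \<in> poly_in I"
  by (induction n) (simp_all add: poly_in_mult, simp add: poly_in_def)

lemma poly_in_X [simp]: "i \<in> I \<Longrightarrow> X i \<in> poly_in I"
  by (simp add: poly_in_def X_def)

lemma poly_in_sum: "(\<And>i. i \<in> A \<Longrightarrow> f i \<in> poly_in I) \<Longrightarrow> (\<Sum>i\<in>A. f i) \<in> poly_in I"
  by (induction A rule: infinite_finite_induct) (simp_all add: poly_in_add)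

lemma P_e_fixed_iff:
  "P_e f = f \<longleftrightarrow> (\<forall>m\<in>Poly_Mapping.keys f. \<forall>i. even (Poly_Mapping.lookup m i))"
  by (auto simp: poly_mapping_eq_iff fun_eq_iff lookup_P_e in_keys_iff split: if_splits)

lemma P_e_diff: "P_e (f - g) = P_e f - P_e g"
  by (simp add: P_e_def lin_ext_diff)

lemma P_e_fixed_mult:
  assumes "P_e f = f" "P_e g = g" shows "P_e (f * g) = f * g"
  unfolding P_e_fixed_iff
proof (intro ballI allI)
  fix m i assume "m \<in> Poly_Mapping.keys (f * g)"
  then obtain a b where "m = a + b" "a \<in> Poly_Mapping.keys f" "b \<in> Poly_Mapping.keys g"
    using Poly_Mapping.keys_mult[of f g] by blast
  then show "even (Poly_Mapping.lookup m i)"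
    using assms by (simp add: P_e_fixed_iff lookup_add)
qed

lemma P_e_X_power: "even i \<Longrightarrow> P_e (X v ^ i) = X v ^ i"
  by (auto simp: P_e_fixed_iff X_power lookup_single when_def)

section \<open>Partial derivatives\<close>

lemma pderiv_add: "pderiv i (f + g) = pderiv i f + pderiv i g"
  and pderiv_diff: "pderiv i (f - g) = pderiv i f - pderiv i g"
  and pderiv_scale: "pderiv i (c *\<^sub>Q f) = c *\<^sub>Q pderiv i f"
  and pderiv_0 [simp]: "pderiv i 0 = 0"
  by (simp_all add: pderiv_def lin_ext_add lin_ext_diff lin_ext_scale)

lemma pderiv_single: "pderiv i (Poly_Mapping.single m c) =
    c *\<^sub>Q Poly_Mapping.single (m - Poly_Mapping.single i 1) (of_nat (Poly_Mapping.lookup m i))"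
  by (simp add: pderiv_def)

lemma single_scaleQ: "Poly_Mapping.single m c = c *\<^sub>Q Poly_Mapping.single m (1::rat)"
  by (rule poly_mapping_eqI) (simp add: lookup_single scaleQ_rat_def when_def)

text \<open>Subtraction of exponents is truncated, so moving it past \<open>n\<close> requires that
  the variable occurs in \<open>m\<close>.\<close>

lemma minus_single_add:
  fixes m n :: "'k \<Rightarrow>\<^sub>0 nat"
  assumes "Poly_Mapping.lookup m i \<noteq> 0"
  shows "m + n - Poly_Mapping.single i 1 = m - Poly_Mapping.single i 1 + n"
  by (rule poly_mapping_eqI)
    (use assms in \<open>auto simp: lookup_add lookup_minus lookup_single when_def\<close>)

lemma pderiv_mult: "pderiv i (f * g) = pderiv i f * g + f * pderiv i g"
proof (induction f rule: monomial_induct)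
  case (monom m)
  show ?case
  proof (induction g rule: monomial_induct)
    case (monom n)
    let ?d = "Poly_Mapping.single i 1 :: nat \<Rightarrow>\<^sub>0 nat"
    let ?s = "\<lambda>m. Poly_Mapping.single m (1::rat)"
    \<comment> \<open>If the exponent is 0, the truncated exponents may differ, but the coefficient
      then vanishes on both sides.\<close>
    have a: "of_nat (Poly_Mapping.lookup m i) *\<^sub>Q ?s (m + n - ?d)
        = of_nat (Poly_Mapping.lookup m i) *\<^sub>Q ?s (m - ?d + n)"
      using minus_single_add[of m i n] by (cases "Poly_Mapping.lookup m i = 0") auto
    have b: "of_nat (Poly_Mapping.lookup n i) *\<^sub>Q ?s (m + n - ?d)
        = of_nat (Poly_Mapping.lookup n i) *\<^sub>Q ?s (m + (n - ?d))"
      using minus_single_add[of n i m]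
      by (cases "Poly_Mapping.lookup n i = 0") (auto simp: add.commute)
    have "pderiv i (?s m * ?s n) = of_nat (Poly_Mapping.lookup m i) *\<^sub>Q ?s (m + n - ?d)
        + of_nat (Poly_Mapping.lookup n i) *\<^sub>Q ?s (m + n - ?d)"
      by (simp add: mult_single pderiv_single lookup_add scaleQ_one single_add
          flip: single_scaleQ)
    also have "\<dots> = pderiv i (?s m) * ?s n + ?s m * pderiv i (?s n)"
      unfolding a b by (simp add: pderiv_single mult_single scaleQ_one flip: single_scaleQ)
    finally show ?case .
  qed (simp_all add: pderiv_add pderiv_scale distrib_left scaleQ_mult_right scaleQ_add_right)
qed (simp_all add: pderiv_add pderiv_scale distrib_right scaleQ_mult_left scaleQ_add_right)

lemma pderiv_X: "pderiv i (X j) = (if i = j then 1 else 0)"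
  by (auto simp: X_def pderiv_single scaleQ_one lookup_single)

lemma pderiv_power: "pderiv i (f ^ n) = of_nat n *\<^sub>Q (f ^ (n - 1) * pderiv i f)"
proof (induction n)
  case 0
  show ?case by (simp add: pderiv_single flip: single_one)
next
  case (Suc n)
  have "f * (of_nat n *\<^sub>Q (f ^ (n - 1) * pderiv i f)) = of_nat n *\<^sub>Q (f ^ n * pderiv i f)"
    by (cases n) (simp_all add: scaleQ_mult_right mult.assoc)
  then show ?case
    by (simp add: pderiv_mult Suc scaleQ_add_left scaleQ_one mult.commute)
qed

section \<open>The bracket takes values in the even parts of the spaces V\<close>

text \<open>In the sum of the two binomial expansions the odd terms cancel and the even terms
  double, which gives the factor 2 of \<open>e_eq\<close>. Powers of linear forms are easier to
  differentiate and to substitute into than the expansion.\<close>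

lemma e_closed_form: "e k = (X 1 + X 2) ^ (2 * k) + (X 1 - X 2) ^ (2 * k)"
proof -
  have pow: "(- X 2) ^ j = (-1) ^ j *\<^sub>Q X 2 ^ j" for j
    by (induction j) (simp_all add: scaleQ_mult_left scaleQ_mult_right)
  have plus: "(X 1 + X 2) ^ (2 * k) = (\<Sum>i\<le>2*k. of_nat (2*k choose i) *\<^sub>Q mono2 i (2*k - i))"
    unfolding binomial_ring by (simp add: mono2_eq of_nat_mult_scaleQ scaleQ_mult_left)
  have "(X 1 + - X 2) ^ (2 * k)
      = (\<Sum>i\<le>2*k. (of_nat (2*k choose i) * (-1) ^ (2*k - i)) *\<^sub>Q mono2 i (2*k - i))"
    unfolding binomial_ring pow
    by (simp add: mono2_eq of_nat_mult_scaleQ scaleQ_mult_left scaleQ_mult_right scaleQ_scaleQ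
        mult.commute[where 'a = rat])
  then have minus: "(X 1 - X 2) ^ (2 * k)
      = (\<Sum>i\<le>2*k. (of_nat (2*k choose i) * (-1) ^ (2*k - i)) *\<^sub>Q mono2 i (2*k - i))"
    by simp
  show ?thesis
    unfolding e_eq plus minus rat_vector.scale_sum_right sum.distrib[symmetric]
    by (intro sum.cong) (auto simp: scaleQ_scaleQ mult.commute simp flip: scaleQ_add_left)
qed

definition even_form :: "nat \<Rightarrow> mpoly \<Rightarrow> mpoly \<Rightarrow> mpoly" where
  "even_form k a b = (a + b) ^ (2 * k) + (a - b) ^ (2 * k)"

lemma subst2_e: "subst2 (e k) a b = even_form k a b"
  unfolding e_closed_form even_form_def by (simp add: subst2_hom)

lemma even_power_uminus: "(- a) ^ (2 * k) = a ^ (2 * k)" for a :: mpoly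
  by simp

lemma even_power_minus_commute: "(a - b) ^ (2 * k) = (b - a) ^ (2 * k)" for a b :: mpoly
  using even_power_uminus[of "a - b" k] by simp

lemma even_form_commute: "even_form k a b = even_form k b a"
  unfolding even_form_def using even_power_minus_commute[of a b k] by (simp add: add.commute)

lemma even_form_uminus:
  shows "even_form k a (- b) = even_form k a b"
    and "even_form k (- a) b = even_form k a b"
proof -
  show r: "even_form k a (- b) = even_form k a b" for a b
    by (simp add: even_form_def add.commute)
  show "even_form k (- a) b = even_form k a b"
    using r[of b a] by (simp add: even_form_commute)
qed

lemma ihara_e:
  "ihara (e k) (e l) =
     even_form k (X 1) (X 2) * (even_form l (X 1) (X 3) - even_form l (X 2) (X 3))
   + even_form k (X 2) (X 3) * (even_form l (X 1) (X 2) - even_form l (X 1) (X 3))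
   + even_form k (X 3) (X 1) * (even_form l (X 2) (X 3) - even_form l (X 1) (X 2))"
  by (simp add: ihara_def subst2_e)

text \<open>The operator in the definition of \<open>V\<close>, with open indices, so that its
  cyclic rotations can be treated together.\<close>

definition quartic :: "nat \<Rightarrow> nat \<Rightarrow> nat \<Rightarrow> mpoly \<Rightarrow> mpoly" where
  "quartic i j k f = (pderiv i ^^ 4) f + (pderiv j ^^ 4) f + (pderiv k ^^ 4) f
         - 2 *\<^sub>Q (pderiv i ^^ 2) ((pderiv j ^^ 2) f)
         - 2 *\<^sub>Q (pderiv j ^^ 2) ((pderiv k ^^ 2) f)
         - 2 *\<^sub>Q (pderiv k ^^ 2) ((pderiv i ^^ 2) f)"

lemma funpow_4_2: "(d ^^ 4) f = d (d (d (d f)))" "(d ^^ 2) f = d (d f)"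
  by (simp_all add: numeral_eq_Suc)

lemma quartic_add: "quartic i j k (f + g) = quartic i j k f + quartic i j k g"
  and quartic_diff: "quartic i j k (f - g) = quartic i j k f - quartic i j k g"
  unfolding quartic_def funpow_4_2
  by (simp_all add: pderiv_add pderiv_diff scaleQ_add_right rat_vector.scale_right_diff_distrib)

text \<open>
  The symbol of the operator is
  \<open>- (\<xi>\<^sub>i + \<xi>\<^sub>j + \<xi>\<^sub>k) (\<xi>\<^sub>i + \<xi>\<^sub>j - \<xi>\<^sub>k) (\<xi>\<^sub>i - \<xi>\<^sub>j + \<xi>\<^sub>k) (- \<xi>\<^sub>i + \<xi>\<^sub>j + \<xi>\<^sub>k)\<close>,
  and one of its factors is \<open>\<xi>\<^sub>i - s \<xi>\<^sub>j - t \<xi>\<^sub>k\<close> up to sign, which kills the family \<open>c\<close>.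
\<close>
lemma quartic_eq_0:
  assumes c: "\<And>a b. pderiv i (c a b) = c (Suc a) b + c a (Suc b)"
    "\<And>a b. pderiv j (c a b) = s *\<^sub>Q c (Suc a) b"
    "\<And>a b. pderiv k (c a b) = t *\<^sub>Q c a (Suc b)"
    and s: "s * s = 1" and t: "t * t = 1"
  shows "quartic i j k (c 0 0) = 0" "quartic j k i (c 0 0) = 0" "quartic k i j (c 0 0) = 0"
proof -
  have two: "2 *\<^sub>Q x = x + x" for x :: mpoly
    using scaleQ_add_left[of 1 1 x] by (simp add: scaleQ_one)
  \<comment> \<open>Only second derivatives enter, so the signs \<open>s\<close> and
    \<open>t\<close> square away. If \<open>A\<close> and \<open>B\<close> denote the shifts of the
    two indices of \<open>c\<close>, the second derivatives act as \<open>(A + B)^2\<close>,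
    \<open>A^2\<close> and \<open>B^2\<close>, and the operator becomes
    \<open>((A + B)^2 - A^2 - B^2)^2 - 4 A^2 B^2 = 0\<close>.\<close>
  have i: "pderiv i (pderiv i (c a b))
      = c (Suc (Suc a)) b + c (Suc a) (Suc b) + c (Suc a) (Suc b) + c a (Suc (Suc b))"
    and j: "pderiv j (pderiv j (c a b)) = c (Suc (Suc a)) b"
    and k: "pderiv k (pderiv k (c a b)) = c a (Suc (Suc b))" for a b
    by (simp_all add: pderiv_add pderiv_scale c scaleQ_scaleQ s t scaleQ_one algebra_simps)
  show "quartic i j k (c 0 0) = 0" "quartic j k i (c 0 0) = 0" "quartic k i j (c 0 0) = 0"
    unfolding quartic_def funpow_4_2 two i j k pderiv_add by simp_all
qed

text \<open>With falling factorials as coefficients the family indexed by \<open>a\<close> and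
  \<open>b\<close> is closed under differentiation. Once \<open>a\<close> exceeds \<open>m\<close>,
  the product contains the factor 0, which absorbs the truncated exponent \<open>m - a\<close>;
  likewise for \<open>b\<close> and \<open>n\<close>.\<close>

lemma pderiv_power_prod:
  assumes "pderiv v A = x *\<^sub>Q 1" "pderiv v B = y *\<^sub>Q 1"
  shows "pderiv v (((\<Prod>r<a. of_nat (m - r)) * (\<Prod>r<b. of_nat (n - r))) *\<^sub>Q (A ^ (m - a) * B ^ (n - b)))
    = x *\<^sub>Q (((\<Prod>r<Suc a. of_nat (m - r)) * (\<Prod>r<b. of_nat (n - r))) *\<^sub>Q (A ^ (m - Suc a) * B ^ (n - b)))
    + y *\<^sub>Q (((\<Prod>r<a. of_nat (m - r)) * (\<Prod>r<Suc b. of_nat (n - r))) *\<^sub>Q (A ^ (m - a) * B ^ (n - Suc b)))"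
  by (simp add: pderiv_scale pderiv_mult pderiv_power assms scaleQ_mult_left scaleQ_mult_right
      scaleQ_scaleQ scaleQ_add_right mult_ac)

lemma quartic_power_prod:
  fixes m n :: nat
  assumes "distinct [i, j, k]" and s: "s = 1 \<or> s = -1" and t: "t = 1 \<or> t = -1"
  defines "h \<equiv> (X i + s *\<^sub>Q X j) ^ m * (X i + t *\<^sub>Q X k) ^ n"
  shows "quartic i j k h = 0" "quartic j k i h = 0" "quartic k i j h = 0"
proof -
  \<comment> \<open>The indices count how often the first and the second factor of \<open>h\<close>
    have been differentiated; this is the family that \<open>quartic_eq_0\<close> asks for.\<close>
  define c where "c a b = ((\<Prod>r<a. of_nat (m - r)) * (\<Prod>r<b. of_nat (n - r))) *\<^sub>Q
      ((X i + s *\<^sub>Q X j) ^ (m - a) * (X i + t *\<^sub>Q X k) ^ (n - b))" for a b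
  have h: "h = c 0 0"
    by (simp add: h_def c_def scaleQ_one)
  have i: "pderiv i (c a b) = 1 *\<^sub>Q c (Suc a) b + 1 *\<^sub>Q c a (Suc b)"
    and j: "pderiv j (c a b) = s *\<^sub>Q c (Suc a) b + 0 *\<^sub>Q c a (Suc b)"
    and k: "pderiv k (c a b) = 0 *\<^sub>Q c (Suc a) b + t *\<^sub>Q c a (Suc b)" for a b
    unfolding c_def by (rule pderiv_power_prod;
      use assms(1) in \<open>simp add: pderiv_add pderiv_scale pderiv_X scaleQ_one\<close>)+
  have "s * s = 1" "t * t = 1" using s t by auto
  from quartic_eq_0[of i c j s k t, OF _ _ _ this]
  show "quartic i j k h = 0" "quartic j k i h = 0" "quartic k i j h = 0"
    unfolding h i j k by (simp_all add: scaleQ_one)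
qed

text \<open>Expanding the even forms leaves four products covered by
  \<open>quartic_power_prod\<close>. The three rotations allow the variable shared by the two
  factors to be any of the three variables of a fixed operator.\<close>

lemma quartic_even_forms:
  fixes m n :: nat
  assumes "distinct [i, j, k]"
  defines "h \<equiv> even_form m (X i) (X j) * even_form n (X i) (X k)"
  shows "quartic i j k h = 0" "quartic j k i h = 0" "quartic k i j h = 0"
proof -
  have plus: "X i + X j = X i + 1 *\<^sub>Q X j" and minus: "X i - X j = X i + (-1) *\<^sub>Q X j" for i j
    by (simp_all add: scaleQ_one)
  show "quartic i j k h = 0" "quartic j k i h = 0" "quartic k i j h = 0"
    unfolding h_def even_form_def distrib_left distrib_right quartic_add plus minus
    by (simp_all only: quartic_power_prod[OF assms(1)] simp_thms add_0)
qed

lemma quartic_ihara_e: "quartic 1 2 3 (ihara (e k) (e l)) = 0"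
proof -
  \<comment> \<open>In each of the six products the two factors share exactly one variable; symmetry
    of the even forms puts it first in both.\<close>
  have *: "ihara (e k) (e l) =
      even_form k (X 1) (X 2) * even_form l (X 1) (X 3) - even_form k (X 2) (X 1) * even_form l (X 2) (X 3)
    + (even_form k (X 2) (X 3) * even_form l (X 2) (X 1) - even_form k (X 3) (X 2) * even_form l (X 3) (X 1))
    + (even_form k (X 3) (X 1) * even_form l (X 3) (X 2) - even_form k (X 1) (X 3) * even_form l (X 1) (X 2))"
    unfolding ihara_e even_form_commute[of _ "X 2" "X 1"] even_form_commute[of _ "X 3" "X 1"]
      even_form_commute[of _ "X 3" "X 2"]
    by (simp add: algebra_simps)
  have 1: "quartic 1 2 3 (even_form m (X 1) (X 2) * even_form n (X 1) (X 3)) = 0"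
    "quartic 1 2 3 (even_form m (X 1) (X 3) * even_form n (X 1) (X 2)) = 0" for m n
    using quartic_even_forms(1)[of 1 2 3 m n] quartic_even_forms(1)[of 1 2 3 n m]
    by (simp_all add: mult.commute)
  have 2: "quartic 1 2 3 (even_form m (X 2) (X 3) * even_form n (X 2) (X 1)) = 0"
    "quartic 1 2 3 (even_form m (X 2) (X 1) * even_form n (X 2) (X 3)) = 0" for m n
    using quartic_even_forms(3)[of 2 3 1 m n] quartic_even_forms(3)[of 2 3 1 n m]
    by (simp_all add: mult.commute)
  have 3: "quartic 1 2 3 (even_form m (X 3) (X 1) * even_form n (X 3) (X 2)) = 0"
    "quartic 1 2 3 (even_form m (X 3) (X 2) * even_form n (X 3) (X 1)) = 0" for m n
    using quartic_even_forms(2)[of 3 1 2 m n] quartic_even_forms(2)[of 3 1 2 n m]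
    by (simp_all add: mult.commute)
  show ?thesis
    unfolding * quartic_add quartic_diff 1 2 3 by simp
qed

lemma poly_in_even_form: "a \<in> poly_in I \<Longrightarrow> b \<in> poly_in I \<Longrightarrow> even_form k a b \<in> poly_in I"
  by (simp add: even_form_def poly_in_add poly_in_diff poly_in_power)

lemma homogeneous_even_form:
  assumes "homogeneous 1 a" "homogeneous 1 b" shows "homogeneous (2 * k) (even_form k a b)"
  unfolding even_form_def
  using homogeneous_power[OF homogeneous_add[OF assms], of "2 * k"]
    homogeneous_power[OF homogeneous_diff[OF assms], of "2 * k"]
  by (simp add: homogeneous_add)

lemma P_e_0 [simp]: "P_e 0 = 0"
  by (simp add: P_e_def)

text \<open>The expansion \<open>e_eq\<close> contains only even exponents, and renaming the
  variables keeps them even.\<close>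

lemma P_e_even_form: "P_e (even_form k (X i) (X j)) = even_form k (X i) (X j)"
proof -
  have "even_form k (X i) (X j) = subst2 (e k) (X i) (X j)"
    by (simp add: subst2_e)
  also have "\<dots> = 2 *\<^sub>Q (\<Sum>a\<le>2*k. if even a \<and> even (2*k - a)
     then of_nat (2*k choose a) *\<^sub>Q (X i ^ a * X j ^ (2*k - a)) else 0)"
    unfolding e_eq subst2_hom subst2_sum
    by (intro arg_cong[of _ _ "scaleQ 2"] sum.cong) (auto simp: subst2_hom subst2_mono2)
  finally show ?thesis
    by (simp add: P_e_scale P_e_sum if_distrib[of P_e] P_e_fixed_mult P_e_X_power
        cong: if_cong)
qed

lemma subst3_even_form:
  "subst3 f a b c = subst (X(1 := a, 2 := b, 3 := c)) f"
  "subst \<sigma> (even_form k a' b') = even_form k (subst \<sigma> a') (subst \<sigma> b')"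
  by (simp_all add: subst3_def even_form_def subst_hom)

lemma subst3_ihara_e:
  "subst3 (ihara (e k) (e l)) a b c =
     even_form k a b * (even_form l a c - even_form l b c)
   + even_form k b c * (even_form l a b - even_form l a c)
   + even_form k c a * (even_form l b c - even_form l a b)"
  unfolding ihara_e subst3_def by (simp add: subst_hom subst3_even_form)

lemma ihara_e_in_V: "ihara (e k) (e l) \<in> V (k + l)"
proof -
  let ?f = "ihara (e k) (e l)"
  have in3: "?f \<in> poly_in {1, 2, 3}"
    unfolding ihara_e
    by (intro poly_in_add poly_in_diff poly_in_mult poly_in_even_form poly_in_X) auto
  have "homogeneous (2 * k + 2 * l) ?f"
    unfolding ihara_e
    by (intro homogeneous_add homogeneous_diff homogeneous_mult homogeneous_even_form homogeneous_X)
  then have hom: "homogeneous (2 * (k + l)) ?f"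
    by (simp add: algebra_simps)
  note sub = subst3_ihara_e[of k l]
  have cyc: "?f = subst3 ?f (X 2) (X 3) (X 1)"
    unfolding sub unfolding ihara_e even_form_commute[of _ "X 2" "X 1"]
      even_form_commute[of _ "X 3" "X 1"] even_form_commute[of _ "X 3" "X 2"]
    by (simp add: algebra_simps)
  have anti: "?f = - subst3 ?f (X 3) (X 2) (X 1)"
    unfolding sub unfolding ihara_e even_form_commute[of _ "X 2" "X 1"]
      even_form_commute[of _ "X 3" "X 1"] even_form_commute[of _ "X 3" "X 2"]
    by (simp add: algebra_simps)
  \<comment> \<open>Both sides of the functional equation of \<open>V\<close> vanish. By evenness
    the arguments on the right act as if two of them were equal, where the bracket is 0; on the left
    two equal values are subtracted.\<close>
  have "subst3 ?f (- X 2) (X 2) (X 3) = 0" "subst3 ?f (X 2) (- X 3) (X 3) = 0"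
    "subst3 ?f 0 (X 2) (- X 3) = subst3 ?f 0 (X 2) (X 3)"
    unfolding sub even_form_uminus
      even_form_commute[of _ "X 3" "X 2"] even_form_commute[of _ "X 3" 0]
    by (simp_all add: algebra_simps even_form_uminus)
  then show ?thesis
    unfolding V_def using in3 hom cyc anti quartic_ihara_e[of k l]
    by (simp add: quartic_def)
qed

lemma P_e_ihara_e: "P_e (ihara (e k) (e l)) = ihara (e k) (e l)"
  unfolding ihara_e P_e_add right_diff_distrib P_e_diff
  by (simp add: P_e_fixed_mult P_e_even_form)

section \<open>The exterior square of E\<close>

text \<open>In the free space each of these identities is, after regrouping, one of the generators
  of \<open>ext2_relations\<close>.\<close>

lemma
  shows wedge_add_left: "wedge (u + u') v = wedge u v + wedge u' v"
    and wedge_add_right: "wedge u (v + v') = wedge u v + wedge u v'"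
    and wedge_scale_left: "wedge (c *\<^sub>Q u) v = c *\<^sub>Q wedge u v"
    and wedge_scale_right: "wedge u (c *\<^sub>Q v) = c *\<^sub>Q wedge u v"
    and wedge_self: "wedge u u = 0"
  by (transfer; unfold ext2_relations_def diff_diff_add[symmetric] diff_0_right;
    rule rat_vector.span_base; blast)+

lemma wedge_swap: "wedge v u = - wedge u v"
proof -
  have "wedge (u + v) (u + v) = wedge u u + wedge v u + (wedge u v + wedge v v)"
    by (simp only: wedge_add_left wedge_add_right)
  then have "wedge u v + wedge v u = 0"
    by (simp add: wedge_self add.commute)
  then show ?thesis by (simp add: eq_neg_iff_add_eq_0 add.commute)
qed

lemma ext2_induct [case_names wedge add scale]:
  fixes \<omega> :: "'a::rat_vector ext2"
  assumes wedge: "\<And>u v. Q (wedge u v)"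
    and add: "\<And>\<omega> \<omega>'. Q \<omega> \<Longrightarrow> Q \<omega>' \<Longrightarrow> Q (\<omega> + \<omega>')"
    and scale: "\<And>c \<omega>. Q \<omega> \<Longrightarrow> Q (c *\<^sub>Q \<omega>)"
  shows "Q \<omega>"
proof (induction \<omega> rule: ext2.abs_induct)
  case (1 t)
  show ?case
  proof (induction t rule: monomial_induct)
    case (monom m)
    then show ?case using wedge[of "fst m" "snd m"] by (simp add: wedge.abs_eq)
  next
    case (add f g)
    then show ?case using assms(2) by (simp flip: plus_ext2.abs_eq)
  next
    case (scale c f)
    then show ?case using assms(3) by (simp flip: scaleQ_ext2.abs_eq)
  qed
qed

text \<open>The generators of \<open>E\<close> start at index 1; the default 0 at index 0 ensures
  that \<open>to_E\<close> is applied only to generators.\<close>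

definition e_vec :: "nat \<Rightarrow> E_vec" where
  "e_vec k = (if k = 0 then 0 else to_E (e k))"

lemma of_E_e_vec: "1 \<le> k \<Longrightarrow> of_E (e_vec k) = e k"
  unfolding e_vec_def by (auto simp: E_def intro!: to_E_inverse rat_vector.span_base)

lemma e_vec_unique: "1 \<le> k \<Longrightarrow> of_E u = e k \<Longrightarrow> u = e_vec k"
  using of_E_e_vec[of k] by (simp flip: of_E_inject)

text \<open>The values of \<open>of_E\<close> on vectors satisfying \<open>Q\<close> form a subspace
  that contains the generators, hence all of \<open>E\<close>.\<close>

lemma E_vec_induct [case_names gen add scale]:
  assumes gen: "\<And>k. 1 \<le> k \<Longrightarrow> Q (e_vec k)"
    and add: "\<And>u v. Q u \<Longrightarrow> Q v \<Longrightarrow> Q (u + v)"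
    and scale: "\<And>c u. Q u \<Longrightarrow> Q (c *\<^sub>Q u)"
  shows "Q u"
proof -
  let ?S = "of_E ` Collect Q"
  have "rat_vector.subspace ?S"
  proof (rule rat_vector.subspaceI)
    have "Q 0" using scale[OF gen[OF order_refl], of 0] by simp
    then show "0 \<in> ?S" by (metis image_eqI mem_Collect_eq zero_E_vec.rep_eq)
  next
    fix x y assume "x \<in> ?S" "y \<in> ?S"
    then show "x + y \<in> ?S" by (auto simp flip: plus_E_vec.rep_eq intro: add)
  next
    fix c x assume "x \<in> ?S"
    then show "c *\<^sub>Q x \<in> ?S" by (auto simp flip: scaleQ_E_vec.rep_eq intro: scale)
  qed
  moreover have "{e k | k. 1 \<le> k} \<subseteq> ?S"
    by (auto simp flip: of_E_e_vec intro!: imageI gen)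
  ultimately have "E \<subseteq> ?S"
    unfolding E_def by (rule rat_vector.span_minimal[rotated])
  with of_E[of u] show ?thesis by (auto simp: of_E_inject)
qed

text \<open>By bilinearity of the wedge, linear statements about the exterior square need checking
  only on wedges of generators.\<close>

lemma ext2_E_induct [case_names gen add scale]:
  fixes \<omega> :: "E_vec ext2"
  assumes gen: "\<And>k l. 1 \<le> k \<Longrightarrow> 1 \<le> l \<Longrightarrow> Q (wedge (e_vec k) (e_vec l))"
    and add: "\<And>\<omega> \<omega>'. Q \<omega> \<Longrightarrow> Q \<omega>' \<Longrightarrow> Q (\<omega> + \<omega>')"
    and scale: "\<And>c \<omega>. Q \<omega> \<Longrightarrow> Q (c *\<^sub>Q \<omega>)"
  shows "Q \<omega>"
proof (induction \<omega> rule: ext2_induct)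
  case (wedge u v)
  show ?case
  proof (induction u rule: E_vec_induct)
    case (gen k)
    show ?case
      by (induction v rule: E_vec_induct)
        (use gen assms in \<open>simp_all add: wedge_add_right wedge_scale_right\<close>)
  qed (simp_all add: wedge_add_left wedge_scale_left add scale)
qed (use add scale in auto)

lemma bracket_map_add: "bracket_map (\<omega> + \<omega>') = bracket_map \<omega> + bracket_map \<omega>'"
  and bracket_map_scale: "bracket_map (c *\<^sub>Q \<omega>) = c *\<^sub>Q bracket_map \<omega>"
  using linear_bracket_map by (simp_all add: Vector_Spaces.linear_iff)

lemma bracket_map_e_vec:
  "1 \<le> k \<Longrightarrow> 1 \<le> l \<Longrightarrow> bracket_map (wedge (e_vec k) (e_vec l)) = ihara (e k) (e l)"
  by (simp add: bracket_map_wedge of_E_e_vec)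

text \<open>On generators the bracket lies in \<open>V (k + l)\<close> and is fixed by
  \<open>P_e\<close>, so it is its own preimage under \<open>P_e\<close>.\<close>

lemma range_bracket_map: "bracket_map \<omega> \<in> sum_P_e_V"
proof (induction \<omega> rule: ext2_E_induct)
  case (gen k l)
  then have "bracket_map (wedge (e_vec k) (e_vec l)) = P_e (ihara (e k) (e l))"
    by (simp add: bracket_map_e_vec P_e_ihara_e)
  also have "\<dots> \<in> P_e ` V (k + l)"
    by (rule imageI) (rule ihara_e_in_V)
  finally show ?case
    using gen unfolding sum_P_e_V_def by (intro rat_vector.span_base) auto
qed (auto simp: sum_P_e_V_def bracket_map_add bracket_map_scale
    intro: rat_vector.span_add rat_vector.span_scale)

section \<open>Encoding the exterior square by alternating polynomials\<close>

text \<open>Restriction to an axis turns \<open>e k\<close> into \<open>2 x^(2k)\<close>, so this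
  determinant of restrictions sends \<open>e k\<close> wedge \<open>e l\<close> to four times the
  polynomial \<open>P\<close> of the overview. In this form it is visibly bilinear and alternating,
  without a choice of basis of \<open>E\<close>.\<close>

lift_definition axis_map :: "E_vec ext2 \<Rightarrow> mpoly"
  is "lin_ext (\<lambda>(u, v). subst2 (of_E u) (X 1) 0 * subst2 (of_E v) (X 2) 0
    - subst2 (of_E u) (X 2) 0 * subst2 (of_E v) (X 1) 0)"
proof -
  let ?b = "\<lambda>(u, v). subst2 (of_E u) (X 1) 0 * subst2 (of_E v) (X 2) 0
    - subst2 (of_E u) (X 2) 0 * subst2 (of_E v) (X 1) 0"
  fix s t :: "E_vec \<times> E_vec \<Rightarrow>\<^sub>0 rat"
  assume "s - t \<in> ext2_relations"
  then have "lin_ext ?b (s - t) = 0"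
    by (rule lin_ext_relations[rotated -1])
      (simp_all add: plus_E_vec.rep_eq scaleQ_E_vec.rep_eq subst2_add subst2_scale algebra_simps
        scaleQ_mult_left scaleQ_mult_right rat_vector.scale_right_diff_distrib)
  then show "lin_ext ?b s = lin_ext ?b t"
    by (simp add: lin_ext_diff)
qed

lemma axis_map_wedge:
  "axis_map (wedge u v) = subst2 (of_E u) (X 1) 0 * subst2 (of_E v) (X 2) 0
    - subst2 (of_E u) (X 2) 0 * subst2 (of_E v) (X 1) 0"
  by transfer (simp add: scaleQ_one)

lemma axis_map_add: "axis_map (\<omega> + \<omega>') = axis_map \<omega> + axis_map \<omega>'"
  by transfer (rule lin_ext_add)

lemma axis_map_scale: "axis_map (c *\<^sub>Q \<omega>) = c *\<^sub>Q axis_map \<omega>"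
  by transfer (rule lin_ext_scale)

lemma linear_axis_map: "Vector_Spaces.linear scaleQ scaleQ axis_map"
  by (simp add: Vector_Spaces.linear_iff rat_vector.vector_space_axioms axis_map_add axis_map_scale)

lemma scaleQ_numeral: "numeral n *\<^sub>Q f = numeral n * f" for f :: mpoly
  by (simp add: scaleQ_eq_mult)

lemma axis_map_e_vec:
  assumes "1 \<le> k" "1 \<le> l"
  shows "axis_map (wedge (e_vec k) (e_vec l))
    = 4 *\<^sub>Q (mono2 (2 * k) (2 * l) - mono2 (2 * l) (2 * k))"
  unfolding axis_map_wedge of_E_e_vec[OF assms(1)] of_E_e_vec[OF assms(2)] subst2_e even_form_def
    mono2_eq scaleQ_numeral
  by (simp add: algebra_simps)

text \<open>The conditions of \<open>W_even\<close> apart from homogeneity and the period relation.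
  This set turns out to be the image of \<open>axis_map\<close>.\<close>

definition alternating_even :: "mpoly set" where
  "alternating_even = {P \<in> poly_in {1, 2}. P_e P = P
     \<and> subst2 P (X 1) 0 = 0 \<and> subst2 P 0 (X 2) = 0
     \<and> subst2 P (X 1) (X 2) + subst2 P (X 2) (X 1) = 0}"

lemma alternating_even_closed:
  shows alternating_even_add:
      "P \<in> alternating_even \<Longrightarrow> P' \<in> alternating_even \<Longrightarrow> P + P' \<in> alternating_even"
    and alternating_even_scale: "P \<in> alternating_even \<Longrightarrow> c *\<^sub>Q P \<in> alternating_even"
proof -
  have swap: "(x + x') + (y + y') = (x + y) + (x' + y')" for x x' y y' :: mpoly
    by (simp add: algebra_simps)
  show "P \<in> alternating_even \<Longrightarrow> P' \<in> alternating_even \<Longrightarrow> P + P' \<in> alternating_even"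
    unfolding alternating_even_def mem_Collect_eq subst2_hom swap
    by (simp add: poly_in_add P_e_add)
  show "P \<in> alternating_even \<Longrightarrow> c *\<^sub>Q P \<in> alternating_even"
    by (simp add: alternating_even_def poly_in_scale P_e_scale subst2_hom flip: scaleQ_add_right)
qed

lemma poly_in_mono2: "mono2 i j \<in> poly_in {1, 2}"
  unfolding mono2_eq by (intro poly_in_mult poly_in_power) auto

lemma axis_map_alternating_even: "axis_map \<omega> \<in> alternating_even"
proof (induction \<omega> rule: ext2_E_induct)
  case (gen k l)
  then have "mono2 (2 * k) (2 * l) - mono2 (2 * l) (2 * k) \<in> alternating_even"
    using poly_in_diff[OF poly_in_mono2[of "2 * k" "2 * l"] poly_in_mono2[of "2 * l" "2 * k"]]
    by (simp add: alternating_even_def P_e_diff P_e_mono2 subst2_hom subst2_mono2 power_0_left)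
  then show ?case
    using gen by (simp add: axis_map_e_vec alternating_even_scale)
qed (simp_all add: axis_map_add axis_map_scale alternating_even_closed)

section \<open>Polynomials in two variables\<close>

lemma subst2_expand:
  assumes "P \<in> poly_in {1, 2}"
  shows "subst2 P a b = (\<Sum>m\<in>Poly_Mapping.keys P. Poly_Mapping.lookup P m *\<^sub>Q
    (a ^ Poly_Mapping.lookup m 1 * b ^ Poly_Mapping.lookup m 2))"
  unfolding subst2_def subst_def lin_ext_def subst_monom_def[symmetric]
proof (rule sum.cong[OF refl])
  fix m assume "m \<in> Poly_Mapping.keys P"
  with assms have "Poly_Mapping.keys m \<subseteq> {1, 2}" by (auto simp: poly_in_def)
  from subst_monom_superset[OF _ this]
  show "Poly_Mapping.lookup P m *\<^sub>Q subst_monom (X(1 := a, 2 := b)) m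
      = Poly_Mapping.lookup P m *\<^sub>Q (a ^ Poly_Mapping.lookup m 1 * b ^ Poly_Mapping.lookup m 2)"
    by simp
qed

lemma poly_in_exponent_eq:
  assumes "P \<in> poly_in {1, 2}" "m \<in> Poly_Mapping.keys P"
  shows "m = Poly_Mapping.single 1 (Poly_Mapping.lookup m 1)
    + Poly_Mapping.single 2 (Poly_Mapping.lookup m 2)"
proof (rule poly_mapping_eqI)
  fix i
  have "Poly_Mapping.keys m \<subseteq> {1, 2}"
    using assms by (auto simp: poly_in_def)
  then have "i = 1 \<or> i = 2 \<or> Poly_Mapping.lookup m i = 0"
    by (metis in_keys_iff insertE singletonD subsetD)
  then show "Poly_Mapping.lookup m i = Poly_Mapping.lookup
      (Poly_Mapping.single 1 (Poly_Mapping.lookup m 1)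
        + Poly_Mapping.single 2 (Poly_Mapping.lookup m 2)) i"
    by (auto simp: lookup_add lookup_single when_def)
qed

lemma subst_X_id [simp]: "subst X f = f"
proof (induction f rule: monomial_induct)
  case (monom m)
  have "(\<Prod>i\<in>A. Poly_Mapping.single (Poly_Mapping.single i (Poly_Mapping.lookup m i)) 1)
      = Poly_Mapping.single (\<Sum>i\<in>A. Poly_Mapping.single i (Poly_Mapping.lookup m i)) (1::rat)"
    if "finite A" for A
    using that by induction (simp_all add: mult_single)
  moreover have "(\<Sum>i\<in>Poly_Mapping.keys m. Poly_Mapping.single i (Poly_Mapping.lookup m i)) = m"
    by (rule poly_mapping_eqI)
      (auto simp: lookup_sum lookup_single when_def in_keys_iff if_distrib cong: if_cong)
  ultimately show ?case
    by (simp add: subst_single subst_monom_def X_power scaleQ_one)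
qed (simp_all add: subst_hom)

lemma subst3_X_id: "subst3 f (X 1) (X 2) (X 3) = f"
  by (simp add: subst3_def)

lemma subst2_X_id: "subst2 f (X 1) (X 2) = f"
  by (simp add: subst2_def)

lemma poly_in_subst2:
  assumes "P \<in> poly_in {1, 2}" "a \<in> poly_in I" "b \<in> poly_in I"
  shows "subst2 P a b \<in> poly_in I"
  unfolding subst2_expand[OF assms(1)]
  by (intro poly_in_sum poly_in_scale poly_in_mult poly_in_power assms)

lemma power_scaleQ: "(c *\<^sub>Q f) ^ n = c ^ n *\<^sub>Q f ^ n" for f :: mpoly
  by (induction n) (simp_all add: scaleQ_one scaleQ_mult_left scaleQ_mult_right scaleQ_scaleQ)

text \<open>On the line of slope \<open>k\<close> the coefficient of each power of the variable is a
  polynomial in \<open>k\<close>; it has infinitely many roots, so it is 0.\<close>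

lemma poly_eq_0_if_zero_on_lines:
  assumes F: "F \<in> poly_in {1, 2}"
    and zero: "\<And>k::nat. subst2 F (X 1) (of_nat k * X 1) = 0"
  shows "F = 0"
proof (rule ccontr)
  assume "F \<noteq> 0"
  then obtain M where M: "M \<in> Poly_Mapping.keys F"
    by (metis ex_in_conv keys_eq_empty)
  \<comment> \<open>\<open>d\<close> is the degree of the monomial \<open>M\<close>,
    \<open>c\<close> selects the part of \<open>F\<close> of degree \<open>d\<close>, and
    \<open>q\<close> is that part with the first variable set to 1.\<close>
  define d where "d = Poly_Mapping.lookup M 1 + Poly_Mapping.lookup M 2"
  define c where "c m = (if Poly_Mapping.lookup m 1 + Poly_Mapping.lookup m 2 = d
    then Poly_Mapping.lookup F m else 0)" for m
  define q where "q = (\<Sum>m\<in>Poly_Mapping.keys F. monom (c m) (Poly_Mapping.lookup m 2))"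
  have root: "poly q (of_nat k) = 0" for k
  proof -
    have "0 = Poly_Mapping.lookup (subst2 F (X 1) (of_nat k * X 1)) (Poly_Mapping.single 1 d)"
      by (simp only: zero lookup_zero)
    also have "\<dots> = (\<Sum>m\<in>Poly_Mapping.keys F. c m * of_nat k ^ Poly_Mapping.lookup m 2)"
      unfolding subst2_expand[OF F] lookup_sum
    proof (rule sum.cong[OF refl])
      fix m :: "nat \<Rightarrow>\<^sub>0 nat"
      let ?i = "Poly_Mapping.lookup m 1" and ?j = "Poly_Mapping.lookup m 2"
      have "X 1 ^ ?i * (of_nat k * X 1) ^ ?j = of_nat k ^ ?j *\<^sub>Q X 1 ^ (?i + ?j)"
        by (simp add: of_nat_mult_scaleQ power_scaleQ scaleQ_mult_right power_add)
      then show "Poly_Mapping.lookup (Poly_Mapping.lookup F m *\<^sub>Q (X 1 ^ ?i * (of_nat k * X 1) ^ ?j))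
          (Poly_Mapping.single 1 d) = c m * of_nat k ^ ?j"
        by (auto simp: c_def X_power scaleQ_rat_def lookup_single when_def
            dest!: arg_cong[of _ _ "\<lambda>m. Poly_Mapping.lookup m 1"])
    qed
    also have "\<dots> = poly q (of_nat k)"
      by (simp add: q_def poly_sum poly_monom)
    finally show ?thesis by simp
  qed
  have "q = 0"
  proof (rule ccontr)
    assume "q \<noteq> 0"
    then have "finite {x. poly q x = 0}" by (rule poly_roots_finite)
    moreover have "range of_nat \<subseteq> {x. poly q x = 0}" using root by auto
    ultimately have "finite (range (of_nat :: nat \<Rightarrow> rat))" by (rule rev_finite_subset)
    then show False by (simp add: finite_image_iff inj_of_nat)
  qed
  \<comment> \<open>Among monomials of degree \<open>d\<close> the exponent of the second variable
    determines the monomial, so no other term contributes.\<close>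
  have "coeff q (Poly_Mapping.lookup M 2)
      = (\<Sum>m\<in>Poly_Mapping.keys F. if m = M then Poly_Mapping.lookup F M else 0)"
    unfolding q_def coeff_sum coeff_monom
  proof (rule sum.cong[OF refl])
    fix m assume m: "m \<in> Poly_Mapping.keys F"
    show "(if Poly_Mapping.lookup m 2 = Poly_Mapping.lookup M 2 then c m else 0)
        = (if m = M then Poly_Mapping.lookup F M else 0)"
      using poly_in_exponent_eq[OF F m] poly_in_exponent_eq[OF F M]
      by (auto simp: c_def d_def)
  qed
  then have "coeff q (Poly_Mapping.lookup M 2) = Poly_Mapping.lookup F M"
    using M by simp
  with M \<open>q = 0\<close> show False by (simp add: in_keys_iff)
qed

section \<open>The kernel of the bracket\<close>

text \<open>This is \<open>R(a,b)\<close> of the overview; its vanishing at the two variables is the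
  last condition of \<open>W_even\<close>.\<close>

definition period_rel :: "mpoly \<Rightarrow> mpoly \<Rightarrow> mpoly \<Rightarrow> mpoly" where
  "period_rel P a b = subst2 P a b - subst2 P a (a + b) - subst2 P (a + b) b"

lemma period_rel_add: "period_rel (P + P') a b = period_rel P a b + period_rel P' a b"
  by (simp add: period_rel_def subst2_hom)

lemma period_rel_scale: "period_rel (c *\<^sub>Q P) a b = c *\<^sub>Q period_rel P a b"
  by (simp add: period_rel_def subst2_hom rat_vector.scale_right_diff_distrib)

lemma subst3_add: "subst3 (f + g) a b c = subst3 f a b c + subst3 g a b c"
  and subst3_scale: "subst3 (r *\<^sub>Q f) a b c = r *\<^sub>Q subst3 f a b c"
  by (simp_all add: subst3_def subst_hom)

text \<open>
  For alternating \<open>P\<close> the period relation reads \<open>P(a,b) + P(b,c) + P(c,a) = 0\<close> with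
  \<open>a + b + c = 0\<close>, and \<open>\<plusminus>(a + x)\<close>, \<open>\<plusminus>(-a + y)\<close>, \<open>\<plusminus>(x + y)\<close> are the linear forms in the bracket.
\<close>
lemma bracket_map_eq_period_rel:
  "4 *\<^sub>Q subst3 (bracket_map \<omega>) a x y =
     period_rel (axis_map \<omega>) (a + x) (- a + y) + period_rel (axis_map \<omega>) (a - x) (- a + y)
   + period_rel (axis_map \<omega>) (a + x) (- a - y) + period_rel (axis_map \<omega>) (a - x) (- a - y)"
proof (induction \<omega> rule: ext2_E_induct)
  case (gen k l)
  \<comment> \<open>The encoding of the wedge is \<open>4 g\<close>, which accounts for the factor 4
    in the claim.\<close>
  define g where "g u v = u ^ (2 * k) * v ^ (2 * l) - u ^ (2 * l) * v ^ (2 * k)" for u v :: mpoly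
  have rel: "period_rel (axis_map (wedge (e_vec k) (e_vec l))) u v
      = 4 *\<^sub>Q (g u v - g u (u + v) - g (u + v) v)" for u v
    by (simp add: period_rel_def axis_map_e_vec[OF gen] subst2_hom subst2_mono2 g_def
        rat_vector.scale_right_diff_distrib)
  have neg: "g (- u) v = g u v" "g u (- v) = g u v" for u v
    by (simp_all add: g_def)
  \<comment> \<open>Evenness of \<open>g\<close> brings all arguments to the forms
    \<open>a + x\<close>, \<open>a - x\<close>, \<open>a + y\<close>, \<open>a - y\<close>,
    \<open>x + y\<close>, \<open>x - y\<close>, the linear forms inside the bracket.\<close>
  have 1: "g u (- a + y) = g u (a - y)" "g u (- a - y) = g u (a + y)"
    "g (- a + y) u = g (a - y) u" "g (- a - y) u = g (a + y) u"
    "g u (y - x) = g u (x - y)" "g u (- x - y) = g u (x + y)"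
    "g (y - x) u = g (x - y) u" "g (- x - y) u = g (x + y) u" for u
    using neg(1)[of "a - y" u] neg(1)[of "a + y" u] neg(2)[of u "a - y"] neg(2)[of u "a + y"]
      neg(1)[of "x - y" u] neg(1)[of "x + y" u] neg(2)[of u "x - y"] neg(2)[of u "x + y"]
    by (simp_all add: algebra_simps)
  have 2: "a + x + (- a + y) = x + y" "a - x + (- a + y) = y - x"
    "a + x + (- a - y) = x - y" "a - x + (- a - y) = - x - y"
    by simp_all
  have ya: "even_form k y a = even_form k a y" by (rule even_form_commute)
  \<comment> \<open>Each of the three kinds of \<open>g\<close> terms runs through all four
    combinations of signs, so its sum factors into products of even forms.\<close>
  show ?case
    unfolding rel 1 2 bracket_map_e_vec[OF gen] subst3_ihara_e ya scaleQ_add_right[symmetric]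
    by (rule arg_cong[of _ _ "scaleQ 4"]) (simp add: g_def even_form_def algebra_simps)
next
  case (scale c \<omega>)
  have "4 *\<^sub>Q c *\<^sub>Q f = c *\<^sub>Q 4 *\<^sub>Q f" for f :: mpoly
    by (simp add: scaleQ_scaleQ mult.commute)
  then show ?case
    by (simp only: bracket_map_scale axis_map_scale period_rel_scale subst3_scale scaleQ_add_right
        scale)
qed (simp add: bracket_map_add axis_map_add period_rel_add subst3_add scaleQ_add_right add_ac)

lemma subst2_axis_map_uminus: "subst2 (axis_map \<omega>) (- a) (- b) = subst2 (axis_map \<omega>) a b"
  by (induction \<omega> rule: ext2_E_induct)
    (simp_all add: axis_map_e_vec axis_map_add axis_map_scale subst2_hom subst2_mono2)

lemma mpoly_double_eq_0: "f + f = 0 \<Longrightarrow> f = 0" for f :: mpoly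
  by (metis mult_2 rat_vector.scale_eq_0_iff scaleQ_numeral zero_neq_numeral)

text \<open>This replaces the bracket by a condition on the encoding. Vanishing of \<open>R\<close>
  kills the four summands of \<open>bracket_map_eq_period_rel\<close>; the converse uses the
  specialisations \<open>a = 0\<close> and \<open>x = a\<close>.\<close>

lemma K_iff_period_rel: "\<omega> \<in> K \<longleftrightarrow> period_rel (axis_map \<omega>) (X 1) (X 2) = 0"
proof -
  let ?r = "period_rel (axis_map \<omega>)"
  let ?R = "?r (X 1) (X 2)"
  have in2: "axis_map \<omega> \<in> poly_in {1, 2}"
    using axis_map_alternating_even by (simp add: alternating_even_def)
  have R: "subst2 ?R a b = ?r a b" for a b
    unfolding period_rel_def
    using subst_subst2[OF in2, of "X(1 := a, 2 := b)", folded subst2_def]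
    by (simp add: subst2_hom)
  have R_in: "?R \<in> poly_in {1, 2}"
    unfolding period_rel_def by (intro poly_in_diff poly_in_subst2 in2 poly_in_add) auto
  have R_neg: "?r (- a) (- b) = ?r a b" for a b
    unfolding period_rel_def
    using subst2_axis_map_uminus[of \<omega> a "a + b"] subst2_axis_map_uminus[of \<omega> "a + b" b]
    by (simp add: subst2_axis_map_uminus)
  show ?thesis
  proof
    assume "?R = 0"
    then have "?r a b = 0" for a b using R[of a b] by (simp add: subst2_hom)
    then have "4 *\<^sub>Q bracket_map \<omega> = 0"
      using bracket_map_eq_period_rel[of \<omega> "X 1" "X 2" "X 3"]
      by (simp only: subst3_X_id add_0)
    then show "\<omega> \<in> K" by (simp add: K_def)
  next
    assume "\<omega> \<in> K"
    then have sum: "?r (a + x) (- a + y) + ?r (a - x) (- a + y)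
        + ?r (a + x) (- a - y) + ?r (a - x) (- a - y) = 0" for a x y
      using bracket_map_eq_period_rel[of \<omega> a x y]
      by (simp add: K_def subst3_def)
    \<comment> \<open>At \<open>a = 0\<close> the four terms coincide in pairs under a simultaneous
      change of signs, which leaves twice the desired relation.\<close>
    have odd_left: "?r (- x) y = - ?r x y" for x y
    proof -
      have "(?r x y + ?r (- x) y) + (?r x y + ?r (- x) y) = 0"
        using sum[of 0 x y] R_neg[of x y] R_neg[of x "- y"] by (simp add: algebra_simps)
      then show ?thesis
        using mpoly_double_eq_0 by (metis add_eq_0_iff)
    qed
    have odd_right: "?r x (- y) = - ?r x y" for x y
      using R_neg[of "- x" y] odd_left[of x y] by simp
    have r0: "?r 0 y = 0" "?r x 0 = 0" for x y
      using odd_left[of 0 y] odd_right[of x 0] mpoly_double_eq_0 by (auto simp: eq_neg_iff_add_eq_0)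
    \<comment> \<open>At \<open>x = a\<close> two of the four terms have first argument 0 and
      vanish; oddness turns the sum of the other two into a difference.\<close>
    have shift: "?r (a + a) (y - a) = ?r (a + a) (y + a)" for a y
      using sum[of a a y] odd_right[of "a + a" "a + y"] by (simp add: r0 algebra_simps)
    have "?r (X 1) (of_nat m * X 1) = 0" for m
    proof (induction m)
      case 0
      show ?case by (simp add: r0)
    next
      case (Suc m)
      \<comment> \<open>Half of the first variable, so that \<open>shift\<close> keeps the first
        argument at \<open>X 1\<close> and raises the second by \<open>X 1\<close>.\<close>
      define a where "a = (1 / 2) *\<^sub>Q X 1"
      have a: "a + a = X 1"
        by (simp add: a_def scaleQ_one flip: scaleQ_add_left)
      have "of_nat (Suc m) * X 1 = (of_nat m * X 1 + a) + a"
        unfolding add.assoc a by (simp add: algebra_simps)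
      with shift[of a "of_nat m * X 1 + a"] Suc show ?case by (simp add: a)
    qed
    then show "?R = 0"
      by (intro poly_eq_0_if_zero_on_lines[OF R_in]) (simp only: R)
  qed
qed

section \<open>The inverse of the encoding\<close>

text \<open>An inverse of \<open>axis_map\<close>, given on single monomials. Both monomials of
  \<open>axis_map_e_vec\<close> contribute the same wedge with factor 4, which explains
  \<open>1 / 8\<close>.\<close>

definition axis_section :: "mpoly \<Rightarrow> E_vec ext2" where
  "axis_section = lin_ext (\<lambda>m. (1 / 8) *\<^sub>Q
     wedge (e_vec (Poly_Mapping.lookup m 1 div 2)) (e_vec (Poly_Mapping.lookup m 2 div 2)))"

lemma axis_section_mono2: "axis_section (mono2 (2 * k) (2 * l)) = (1 / 8) *\<^sub>Q wedge (e_vec k) (e_vec l)"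
  by (simp add: axis_section_def mono2_def scaleQ_one lookup_add lookup_single)

lemma axis_section_hom:
  "axis_section (f + g) = axis_section f + axis_section g"
  "axis_section (f - g) = axis_section f - axis_section g"
  "axis_section (c *\<^sub>Q f) = c *\<^sub>Q axis_section f"
  by (simp_all add: axis_section_def lin_ext_add lin_ext_diff lin_ext_scale)

lemma axis_section_axis_map: "axis_section (axis_map \<omega>) = \<omega>"
proof (induction \<omega> rule: ext2_E_induct)
  case (gen k l)
  let ?w = "wedge (e_vec k) (e_vec l)"
  have "axis_section (axis_map ?w)
      = 4 *\<^sub>Q ((1 / 8) *\<^sub>Q ?w - (1 / 8) *\<^sub>Q wedge (e_vec l) (e_vec k))"
    unfolding axis_map_e_vec[OF gen] axis_section_hom axis_section_mono2 ..
  also have "\<dots> = ((4 * (1 / 8)) + (4 * (1 / 8))) *\<^sub>Q ?w"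
    unfolding wedge_swap[of "e_vec l" "e_vec k"]
    by (simp only: rat_vector.scale_minus_right diff_minus_eq_add scaleQ_add_right scaleQ_scaleQ
        scaleQ_add_left)
  finally show ?case by (simp add: scaleQ_one)
qed (simp_all add: axis_map_add axis_map_scale axis_section_hom)

text \<open>Evenness of the exponents comes from \<open>P_e\<close>. An exponent 0 is excluded
  because such a monomial would survive restriction to an axis, where \<open>P\<close>
  vanishes.\<close>

lemma alternating_even_exponents:
  assumes P: "P \<in> alternating_even" and m: "m \<in> Poly_Mapping.keys P"
  obtains k l where "1 \<le> k" "1 \<le> l" "Poly_Mapping.lookup m 1 = 2 * k" "Poly_Mapping.lookup m 2 = 2 * l"
proof -
  have in2: "P \<in> poly_in {1, 2}" and ev: "P_e P = P"
    and axes: "subst2 P (X 1) 0 = 0" "subst2 P 0 (X 2) = 0"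
    using P by (simp_all add: alternating_even_def)
  let ?m1 = "Poly_Mapping.lookup m 1" and ?m2 = "Poly_Mapping.lookup m 2"
  have unique: "m' = m \<longleftrightarrow> Poly_Mapping.lookup m' 1 = ?m1 \<and> Poly_Mapping.lookup m' 2 = ?m2"
    if "m' \<in> Poly_Mapping.keys P" for m'
    using poly_in_exponent_eq[OF in2 m] poly_in_exponent_eq[OF in2 that] by auto
  have single_eq: "Poly_Mapping.single v a = Poly_Mapping.single v b \<longleftrightarrow> a = b" for v a b :: nat
    by (metis lookup_single_eq)
  have "Poly_Mapping.lookup P m = 0" if "?m2 = 0"
  proof -
    have "0 = Poly_Mapping.lookup (subst2 P (X 1) 0) (Poly_Mapping.single 1 ?m1)"
      by (simp only: axes lookup_zero)
    also have "\<dots> = (\<Sum>m'\<in>Poly_Mapping.keys P. if m' = m then Poly_Mapping.lookup P m else 0)"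
      unfolding subst2_expand[OF in2] lookup_sum
    proof (rule sum.cong[OF refl])
      fix m' assume "m' \<in> Poly_Mapping.keys P"
      from unique[OF this] that
      show "Poly_Mapping.lookup (Poly_Mapping.lookup P m' *\<^sub>Q (X 1 ^ Poly_Mapping.lookup m' 1 * 0 ^ Poly_Mapping.lookup m' 2))
          (Poly_Mapping.single 1 ?m1) = (if m' = m then Poly_Mapping.lookup P m else 0)"
        by (cases "m' = m")
          (auto simp: X_power power_0_left lookup_single single_eq scaleQ_rat_def when_def)
    qed
    also have "\<dots> = Poly_Mapping.lookup P m" using m by simp
    finally show ?thesis by simp
  qed
  moreover have "Poly_Mapping.lookup P m = 0" if "?m1 = 0"
  proof -
    have "0 = Poly_Mapping.lookup (subst2 P 0 (X 2)) (Poly_Mapping.single 2 ?m2)"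
      by (simp only: axes lookup_zero)
    also have "\<dots> = (\<Sum>m'\<in>Poly_Mapping.keys P. if m' = m then Poly_Mapping.lookup P m else 0)"
      unfolding subst2_expand[OF in2] lookup_sum
    proof (rule sum.cong[OF refl])
      fix m' assume "m' \<in> Poly_Mapping.keys P"
      from unique[OF this] that
      show "Poly_Mapping.lookup (Poly_Mapping.lookup P m' *\<^sub>Q (0 ^ Poly_Mapping.lookup m' 1 * X 2 ^ Poly_Mapping.lookup m' 2))
          (Poly_Mapping.single 2 ?m2) = (if m' = m then Poly_Mapping.lookup P m else 0)"
        by (cases "m' = m")
          (auto simp: X_power power_0_left lookup_single single_eq scaleQ_rat_def when_def)
    qed
    also have "\<dots> = Poly_Mapping.lookup P m" using m by simp
    finally show ?thesis by simp
  qed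
  moreover have "even ?m1" "even ?m2"
    using ev m by (simp_all add: P_e_fixed_iff)
  ultimately show ?thesis
    using m that[of "?m1 div 2" "?m2 div 2"] by (fastforce simp: in_keys_iff)
qed

lemma axis_section_expand:
  "axis_section P = (\<Sum>m\<in>Poly_Mapping.keys P. Poly_Mapping.lookup P m *\<^sub>Q (1 / 8) *\<^sub>Q
     wedge (e_vec (Poly_Mapping.lookup m 1 div 2)) (e_vec (Poly_Mapping.lookup m 2 div 2)))"
  by (simp add: axis_section_def lin_ext_def)

lemma axis_map_sum: "axis_map (\<Sum>i\<in>A. w i) = (\<Sum>i\<in>A. axis_map (w i))"
proof -
  have "axis_map 0 = 0" using axis_map_scale[of 0 0] by simp
  then show ?thesis
    by (induction A rule: infinite_finite_induct) (simp_all add: axis_map_add)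
qed

text \<open>Going back and forth antisymmetrises \<open>P\<close>, and an alternating
  \<open>P\<close> equals half the difference of itself and its swap. The factor
  \<open>1 / 2\<close> is 4 times \<open>1 / 8\<close>.\<close>

lemma axis_map_axis_section:
  assumes P: "P \<in> alternating_even"
  shows "axis_map (axis_section P) = P"
proof -
  have in2: "P \<in> poly_in {1, 2}" and alt: "subst2 P (X 1) (X 2) + subst2 P (X 2) (X 1) = 0"
    using P by (simp_all add: alternating_even_def)
  have "axis_map (axis_section P) = (\<Sum>m\<in>Poly_Mapping.keys P. Poly_Mapping.lookup P m *\<^sub>Q
      (1 / 2) *\<^sub>Q (X 1 ^ Poly_Mapping.lookup m 1 * X 2 ^ Poly_Mapping.lookup m 2
        - X 2 ^ Poly_Mapping.lookup m 1 * X 1 ^ Poly_Mapping.lookup m 2))"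
    unfolding axis_section_expand axis_map_sum axis_map_scale
  proof (rule sum.cong[OF refl])
    fix m assume "m \<in> Poly_Mapping.keys P"
    then obtain k l where kl: "1 \<le> k" "1 \<le> l"
      "Poly_Mapping.lookup m 1 = 2 * k" "Poly_Mapping.lookup m 2 = 2 * l"
      by (rule alternating_even_exponents[OF P])
    have div: "2 * n div 2 = n" for n :: nat by simp
    show "Poly_Mapping.lookup P m *\<^sub>Q (1 / 8) *\<^sub>Q
      axis_map (wedge (e_vec (Poly_Mapping.lookup m 1 div 2)) (e_vec (Poly_Mapping.lookup m 2 div 2)))
      = Poly_Mapping.lookup P m *\<^sub>Q
      (1 / 2) *\<^sub>Q (X 1 ^ Poly_Mapping.lookup m 1 * X 2 ^ Poly_Mapping.lookup m 2
        - X 2 ^ Poly_Mapping.lookup m 1 * X 1 ^ Poly_Mapping.lookup m 2)"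
      unfolding kl(3,4) div axis_map_e_vec[OF kl(1,2)] mono2_eq
      by (simp add: scaleQ_scaleQ mult.commute)
  qed
  also have "\<dots> = (1 / 2) *\<^sub>Q (subst2 P (X 1) (X 2) - subst2 P (X 2) (X 1))"
    unfolding subst2_expand[OF in2] sum_subtractf[symmetric] rat_vector.scale_sum_right
    by (rule sum.cong[OF refl])
      (simp only: rat_vector.scale_right_diff_distrib rat_vector.scale_scale mult.commute)
  also have "subst2 P (X 2) (X 1) = - P"
    using alt unfolding subst2_X_id by (simp add: add_eq_0_iff)
  also have "(1 / 2) *\<^sub>Q (subst2 P (X 1) (X 2) - - P) = P"
    unfolding subst2_X_id by (simp add: scaleQ_scaleQ scaleQ_one flip: scaleQ_numeral)
  finally show ?thesis .
qed

section \<open>Period polynomials and the grading\<close>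

definition period_polys :: "mpoly set" where
  "period_polys = {P \<in> alternating_even. period_rel P (X 1) (X 2) = 0}"

lemma W_even_eq: "W_even n = {P \<in> period_polys. homogeneous (2 * n) P}"
  by (auto simp: W_even_def period_polys_def alternating_even_def period_rel_def)

lemma subspace_period_polys: "rat_vector.subspace period_polys"
proof (rule rat_vector.subspaceI)
  show "0 \<in> period_polys"
    by (simp add: period_polys_def alternating_even_def period_rel_def subst2_hom)
qed (simp_all add: period_polys_def alternating_even_closed period_rel_add period_rel_scale)

lemma axis_map_K: "axis_map ` K = period_polys"
proof
  show "axis_map ` K \<subseteq> period_polys"
    by (auto simp: period_polys_def axis_map_alternating_even K_iff_period_rel)
  show "period_polys \<subseteq> axis_map ` K"
  proof
    fix P assume "P \<in> period_polys"
    then have "axis_map (axis_section P) = P" "axis_section P \<in> K"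
      by (simp_all add: period_polys_def axis_map_axis_section K_iff_period_rel)
    then show "P \<in> axis_map ` K" by (metis imageI)
  qed
qed

section \<open>Homogeneous components\<close>

definition hcomp :: "nat \<Rightarrow> mpoly \<Rightarrow> mpoly" where
  "hcomp d = lin_ext (\<lambda>m. if mdeg m = d then Poly_Mapping.single m 1 else 0)"

lemma hcomp_hom:
  "hcomp d (f + g) = hcomp d f + hcomp d g"
  "hcomp d (f - g) = hcomp d f - hcomp d g"
  "hcomp d (c *\<^sub>Q f) = c *\<^sub>Q hcomp d f"
  "hcomp d 0 = 0"
  by (simp_all add: hcomp_def lin_ext_add lin_ext_diff lin_ext_scale)

lemma lookup_hcomp:
  "Poly_Mapping.lookup (hcomp d f) m = (if mdeg m = d then Poly_Mapping.lookup f m else 0)"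
proof -
  have "Poly_Mapping.lookup (hcomp d f) m = (\<Sum>k\<in>Poly_Mapping.keys f. if k = m then
      (if mdeg m = d then Poly_Mapping.lookup f m else 0) else 0)"
    unfolding hcomp_def lin_ext_def lookup_sum
    by (rule sum.cong) (auto simp: lookup_single scaleQ_rat_def)
  then show ?thesis by (auto simp: in_keys_iff)
qed

lemma keys_hcomp: "Poly_Mapping.keys (hcomp d f) = {m \<in> Poly_Mapping.keys f. mdeg m = d}"
  by (auto simp: in_keys_iff lookup_hcomp split: if_splits)

lemma homogeneous_hcomp: "homogeneous d (hcomp d f)"
  by (simp add: homogeneous_iff keys_hcomp)

lemma hcomp_homogeneous: "homogeneous c f \<Longrightarrow> hcomp d f = (if c = d then f else 0)"
  by (rule poly_mapping_eqI) (auto simp: lookup_hcomp homogeneous_iff in_keys_iff)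

lemma sum_hcomp: "f = (\<Sum>d\<in>mdeg ` Poly_Mapping.keys f. hcomp d f)"
  by (rule poly_mapping_eqI) (auto simp: lookup_sum lookup_hcomp in_keys_iff image_iff)

lemma homogeneous_subst_monom:
  assumes "\<And>i. homogeneous 1 (\<sigma> i)"
  shows "homogeneous (mdeg m) (subst_monom \<sigma> m)"
proof -
  have "homogeneous (\<Sum>i\<in>A. Poly_Mapping.lookup m i) (\<Prod>i\<in>A. \<sigma> i ^ Poly_Mapping.lookup m i)"
    if "finite A" for A
    using that
  proof induction
    case empty
    show ?case by (simp add: homogeneous_iff mdeg_def)
  next
    case (insert i A)
    then show ?case
      using homogeneous_mult[OF homogeneous_power[OF assms[of i]]] by simp
  qed
  then show ?thesis by (simp add: subst_monom_def mdeg_def)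
qed

text \<open>Substituting linear forms preserves the degree of every monomial. The polynomial 0
  counts as homogeneous of degree 1, so restrictions to an axis are covered as well.\<close>

lemma hcomp_subst:
  assumes "\<And>i. homogeneous 1 (\<sigma> i)"
  shows "hcomp d (subst \<sigma> f) = subst \<sigma> (hcomp d f)"
proof (induction f rule: monomial_induct)
  case (monom m)
  have "homogeneous (mdeg m) (Poly_Mapping.single m (1::rat))"
    by (simp add: homogeneous_iff)
  then show ?case
    by (simp add: subst_single scaleQ_one hcomp_homogeneous[OF homogeneous_subst_monom[OF assms]]
        hcomp_homogeneous)
qed (simp_all add: hcomp_hom subst_hom)

lemma hcomp_subst2:
  assumes "homogeneous 1 a" "homogeneous 1 b"
  shows "subst2 (hcomp d f) a b = hcomp d (subst2 f a b)"
  unfolding subst2_def by (rule hcomp_subst[symmetric]) (use assms in auto)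

lemma hcomp_period_polys:
  assumes "P \<in> period_polys" shows "hcomp d P \<in> period_polys"
proof -
  have P: "P \<in> poly_in {1, 2}" "P_e P = P" "subst2 P (X 1) 0 = 0" "subst2 P 0 (X 2) = 0"
    "subst2 P (X 1) (X 2) + subst2 P (X 2) (X 1) = 0"
    "subst2 P (X 1) (X 2) - subst2 P (X 1) (X 1 + X 2) - subst2 P (X 1 + X 2) (X 2) = 0"
    using assms by (simp_all add: period_polys_def alternating_even_def period_rel_def)
  have plus: "homogeneous 1 (X 1 + X 2)"
    by (intro homogeneous_add homogeneous_X)
  have "hcomp d P \<in> poly_in {1, 2}" "P_e (hcomp d P) = hcomp d P"
    using P(1,2) by (auto simp: poly_in_def P_e_fixed_iff keys_hcomp)
  then show ?thesis
    unfolding period_polys_def alternating_even_def period_rel_def mem_Collect_eq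
      hcomp_subst2[OF homogeneous_X(1) homogeneous_X(1)]
      hcomp_subst2[OF homogeneous_X(1) homogeneous_0] hcomp_subst2[OF homogeneous_0 homogeneous_X(1)]
      hcomp_subst2[OF homogeneous_X(1) plus] hcomp_subst2[OF plus homogeneous_X(1)]
      hcomp_hom(1,2)[symmetric] P(3-6) hcomp_hom(4)
    by blast
qed

lemma alternating_even_mdeg:
  assumes "P \<in> alternating_even" "m \<in> Poly_Mapping.keys P"
  obtains k l where "1 \<le> k" "1 \<le> l" "Poly_Mapping.lookup m 1 = 2 * k" "Poly_Mapping.lookup m 2 = 2 * l"
    "mdeg m = 2 * (k + l)"
proof -
  obtain k l where kl: "1 \<le> k" "1 \<le> l" "Poly_Mapping.lookup m 1 = 2 * k" "Poly_Mapping.lookup m 2 = 2 * l"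
    using alternating_even_exponents[OF assms] .
  have "m = Poly_Mapping.single 1 (Poly_Mapping.lookup m 1)
      + Poly_Mapping.single 2 (Poly_Mapping.lookup m 2)"
    using assms by (intro poly_in_exponent_eq[of P]) (simp_all add: alternating_even_def)
  then have "mdeg m = Poly_Mapping.lookup m 1 + Poly_Mapping.lookup m 2"
    by (metis mdeg_add mdeg_single)
  then show ?thesis using that[OF kl] kl by simp
qed

lemma sum_W_even_eq: "sum_W_even = period_polys"
proof
  show "sum_W_even \<subseteq> period_polys"
    unfolding sum_W_even_def
    by (rule rat_vector.span_minimal[OF _ subspace_period_polys]) (auto simp: W_even_eq)
  show "period_polys \<subseteq> sum_W_even"
  proof
    fix P assume P: "P \<in> period_polys"
    have "hcomp d P \<in> sum_W_even" if "d \<in> mdeg ` Poly_Mapping.keys P" for d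
    proof -
      obtain m where m: "m \<in> Poly_Mapping.keys P" "d = mdeg m" using \<open>d \<in> _\<close> by auto
      from P have "P \<in> alternating_even" by (simp add: period_polys_def)
      \<comment> \<open>Both exponents are even and positive, so the degree is twice an admissible
        index of \<open>sum_W_even\<close>.\<close>
      then obtain k l where kl: "1 \<le> k" "d = 2 * (k + l)"
        using alternating_even_mdeg[OF _ m(1)] m(2) by metis
      then have "hcomp d P \<in> W_even (k + l)"
        using hcomp_period_polys[OF P] homogeneous_hcomp[of d P] by (simp add: W_even_eq)
      then show ?thesis
        using kl unfolding sum_W_even_def by (intro rat_vector.span_base) auto
    qed
    then have "(\<Sum>d\<in>mdeg ` Poly_Mapping.keys P. hcomp d P) \<in> sum_W_even"
      unfolding sum_W_even_def by (intro rat_vector.span_sum)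
    then show "P \<in> sum_W_even" by (simp flip: sum_hcomp)
  qed
qed

section \<open>Compatibility of the encoding and its inverse with the grading\<close>

lemma homogeneous_axis_map:
  assumes "\<omega> \<in> ext2_E_deg n" shows "homogeneous (2 * n) (axis_map \<omega>)"
proof -
  have "rat_vector.subspace {\<omega>. homogeneous (2 * n) (axis_map \<omega>)}"
  proof (rule rat_vector.subspaceI)
    have "axis_map 0 = 0" using axis_map_scale[of 0 0] by simp
    then show "0 \<in> {\<omega>. homogeneous (2 * n) (axis_map \<omega>)}" by simp
  qed (simp_all add: axis_map_add axis_map_scale homogeneous_add homogeneous_scale)
  moreover have "homogeneous (2 * n) (axis_map (wedge u v))"
    if "1 \<le> k" "1 \<le> l" "k + l = n" "of_E u = e k" "of_E v = e l" for u v k l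
  proof -
    have "homogeneous (2 * n) (mono2 (2 * k) (2 * l) - mono2 (2 * l) (2 * k))"
      using that(3) by (intro homogeneous_diff) (auto simp: mono2_def homogeneous_iff mdeg_add)
    moreover have "u = e_vec k" "v = e_vec l"
      using that by (simp_all add: e_vec_unique)
    ultimately show ?thesis
      using that by (simp add: axis_map_e_vec homogeneous_scale)
  qed
  ultimately have "ext2_E_deg n \<subseteq> {\<omega>. homogeneous (2 * n) (axis_map \<omega>)}"
    unfolding ext2_E_deg_def by (intro rat_vector.span_minimal) auto
  with assms show ?thesis by blast
qed

lemma axis_section_homogeneous:
  assumes "P \<in> alternating_even" "homogeneous (2 * n) P"
  shows "axis_section P \<in> ext2_E_deg n"
proof -
  have "wedge (e_vec (Poly_Mapping.lookup m 1 div 2)) (e_vec (Poly_Mapping.lookup m 2 div 2))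
      \<in> ext2_E_deg n" if m: "m \<in> Poly_Mapping.keys P" for m
  proof -
    obtain k l where kl: "1 \<le> k" "1 \<le> l" "Poly_Mapping.lookup m 1 = 2 * k"
      "Poly_Mapping.lookup m 2 = 2 * l" "mdeg m = 2 * (k + l)"
      using alternating_even_mdeg[OF assms(1) m] .
    have "k + l = n" using kl(5) m assms(2) by (simp add: homogeneous_iff)
    have div: "2 * n div 2 = n" for n :: nat by simp
    have "of_E (e_vec k) = e k" "of_E (e_vec l) = e l"
      using kl(1,2) by (simp_all add: of_E_e_vec)
    then show ?thesis
      unfolding kl(3,4) div ext2_E_deg_def
      using kl(1,2) \<open>k + l = n\<close> by (intro rat_vector.span_base) blast
  qed
  then show ?thesis
    unfolding axis_section_expand ext2_E_deg_def
    by (intro rat_vector.span_sum rat_vector.span_scale)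
qed

lemma axis_map_K_deg: "axis_map ` (K \<inter> ext2_E_deg n) = W_even n"
proof
  show "axis_map ` (K \<inter> ext2_E_deg n) \<subseteq> W_even n"
    using axis_map_K homogeneous_axis_map by (auto simp: W_even_eq)
  show "W_even n \<subseteq> axis_map ` (K \<inter> ext2_E_deg n)"
  proof
    fix P assume "P \<in> W_even n"
    then have P: "P \<in> period_polys" "P \<in> alternating_even" "homogeneous (2 * n) P"
      by (simp_all add: W_even_eq period_polys_def)
    from P(1,2) have *: "axis_map (axis_section P) = P" "axis_section P \<in> K"
      by (simp_all add: period_polys_def axis_map_axis_section K_iff_period_rel)
    show "P \<in> axis_map ` (K \<inter> ext2_E_deg n)"
      by (rule image_eqI[where x = "axis_section P"]) (simp_all add: * axis_section_homogeneous P)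
  qed
qed

theorem proposition3p7:
  shows "range bracket_map \<subseteq> sum_P_e_V
    \<and> (\<exists>\<phi> :: E_vec ext2 \<Rightarrow> mpoly.
           Vector_Spaces.linear scaleQ scaleQ \<phi> \<and> bij_betw \<phi> K sum_W_even
         \<and> (\<forall>n\<ge>1. \<phi> ` (K \<inter> ext2_E_deg n) = W_even n))"
proof (intro conjI exI[of _ axis_map])
  show "range bracket_map \<subseteq> sum_P_e_V"
    using range_bracket_map by blast
  \<comment> \<open>The left inverse gives injectivity on the whole exterior square, hence on
    \<open>K\<close>.\<close>
  have "inj axis_map"
    by (rule inj_on_inverseI) (rule axis_section_axis_map)
  then show "bij_betw axis_map K sum_W_even"
    unfolding bij_betw_def sum_W_even_eq by (auto intro: inj_on_subset simp: axis_map_K)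
qed (simp_all add: linear_axis_map axis_map_K_deg)

end
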